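(* Let $d\ge1$, $s\in(1,2)$, let $u:\mathbb{R}^d\to\mathbb{R}$ be continuous and $x\in\mathbb{R}^d$. For every $p\in\partial u(x)$, let $v_p$ be the radial rearrangement of $\tilde u_p(y)=u(x+y)-u(x)-y\cdot p$. Then $$\mathrm{MA}_su(x)=\sup_{p\in\partial u(x)}\ -c_{d,s}(-\Delta)^{s/2}v_p(0).$$
   Context: $\partial u(x)=\{b\in\mathbb{R}^d:u(z)\ge u(x)+b\cdot(z-x)\ \forall z\in\mathbb{R}^d\}$. An admissible kernel is a measurable function $K:\mathbb{R}^d\to[0,\infty]$ such that $|\{y:K(y)>r^{-d-s}\}|=|B_r|$ for every $r>0$. Define $\mathrm{MA}_su(x)=-\infty$ if $\partial u(x)=\emptyset$, and otherwise $\mathrm{MA}_su(x)=\sup_{b\in\partial u(x)}\inf_{K\text{ admissible}}\int_{\mathbb{R}^d}(u(x+y)-u(x)-y\cdot b)K(y)\,dy\in[0,+\infty]$. The supremum over the empty set is $-\infty$. The radial rearrangement of the nonnegative function $\tilde u_p$ is the (a.e. unique) function $v_p:\mathbb{R}^d\to[0,\infty)$ which is radially symmetric, monotone increasing (nondecreasing) along rays from the origin, and satisfies $|\{y:\tilde u_p(y)<\lambda\}|=|\{y:v_p(y)<\lambda\}|$ for all $\lambda>0$; in particular $v_p(0)=0$. The constant $c_{d,s}$ depends only on $d,s$ and is the one such that $-c_{d,s}(-\Delta)^{s/2}$ is the integral operator with kernel $|y|^{-d-s}$; thus, for a radial nonnegative $v$ with $v(0)=0$, $-c_{d,s}(-\Delta)^{s/2}v(0)=\int_{\mathbb{R}^d}v(y)|y|^{-d-s}\,dy\in[0,+\infty]$.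 *)

theory Defs
  imports "HOL-Analysis.Analysis"
begin

definition subdifferential :: "('a::euclidean_space \<Rightarrow> real) \<Rightarrow> 'a \<Rightarrow> 'a set" where
  "subdifferential u x = {b. \<forall>z. u z \<ge> u x + b \<bullet> (z - x)}"

definition admissible_kernel :: "real \<Rightarrow> ('a::euclidean_space \<Rightarrow> ennreal) \<Rightarrow> bool" where
  "admissible_kernel s K \<longleftrightarrow> K \<in> borel_measurable lebesgue \<and>
     (\<forall>r>0. emeasure lebesgue {y. K y > ennreal (r powr (- real DIM('a) - s))}
            = emeasure lebesgue (ball (0::'a) r))"

definition affine_remainder :: "('a::euclidean_space \<Rightarrow> real) \<Rightarrow> 'a \<Rightarrow> 'a \<Rightarrow> 'a \<Rightarrow> real" where
  "affine_remainder u x b y = u (x + y) - u x - y \<bullet> b"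

text \<open>For \<open>b\<close> in the subdifferential the affine remainder is nonnegative, so the coercion
  to \<open>ennreal\<close> does not truncate and the integral is the Lebesgue integral with values in
  \<open>[0, \<infinity>]\<close>.\<close>

definition MA :: "real \<Rightarrow> ('a::euclidean_space \<Rightarrow> real) \<Rightarrow> 'a \<Rightarrow> ereal" where
  "MA s u x =
     (if subdifferential u x = {} then - \<infinity>
      else SUP b \<in> subdifferential u x.
             enn2ereal (INF K \<in> {K. admissible_kernel s K}.
               \<integral>\<^sup>+ y. ennreal (affine_remainder u x b y) * K y \<partial>lebesgue))"

text \<open>The conditions determine \<open>v\<close> only almost everywhere, hence a predicate.\<close>

definition radial_rearrangement ::
    "('a::euclidean_space \<Rightarrow> real) \<Rightarrow> ('a \<Rightarrow> real) \<Rightarrow> bool" where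
  "radial_rearrangement w v \<longleftrightarrow>
     (\<forall>y. 0 \<le> v y) \<and>
     (\<forall>y z. norm y = norm z \<longrightarrow> v y = v z) \<and>
     (\<forall>y t t'. 0 \<le> t \<and> t \<le> t' \<longrightarrow> v (t *\<^sub>R y) \<le> v (t' *\<^sub>R y)) \<and>
     (\<forall>l>0. emeasure lebesgue {y. w y < l} = emeasure lebesgue {y. v y < l})"

definition extended_integral :: "('a::euclidean_space \<Rightarrow> real) \<Rightarrow> ereal" where
  "extended_integral f =
     enn2ereal (\<integral>\<^sup>+ y. ennreal (f y) \<partial>lebesgue) - enn2ereal (\<integral>\<^sup>+ y. ennreal (- f y) \<partial>lebesgue)"

text \<open>The operator \<open>- c (- \<Delta>)\<^bsup>s/2\<^esup>\<close>, with \<open>c\<close> normalised so that the kernel is exactly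
  \<open>|y|\<^bsup>-d-s\<^esup>\<close>. Symmetrised second differences replace the principal value of the integral of
  \<open>(v (x + y) - v x) |y|\<^bsup>-d-s\<^esup>\<close>. The value of the kernel at \<open>y = 0\<close> is irrelevant (null set).\<close>

definition scaled_neg_frac_laplacian ::
    "real \<Rightarrow> ('a::euclidean_space \<Rightarrow> real) \<Rightarrow> 'a \<Rightarrow> ereal" where
  "scaled_neg_frac_laplacian s v x =
     extended_integral (\<lambda>y. (v (x + y) + v (x - y) - 2 * v x) / 2 * norm y powr (- real DIM('a) - s))"

lemma scaled_neg_frac_laplacian_radial_0:
  fixes v :: "'a::euclidean_space \<Rightarrow> real"
  assumes "\<And>y. 0 \<le> v y" "\<And>y z. norm y = norm z \<Longrightarrow> v y = v z" "v 0 = 0"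
  shows "scaled_neg_frac_laplacian s v 0 =
    enn2ereal (\<integral>\<^sup>+ y. ennreal (v y * norm y powr (- real DIM('a) - s)) \<partial>lebesgue)"
proof -
  have eq: "(v (0 + y) + v (0 - y) - 2 * v 0) / 2 = v y" for y
    using assms(2)[of "- y" y] assms(3) by simp
  have "(\<integral>\<^sup>+ y. ennreal (- (v y * norm y powr (- real DIM('a) - s))) \<partial>lebesgue) = 0"
    using assms(1) by (simp add: ennreal_neg)
  then show ?thesis
    unfolding scaled_neg_frac_laplacian_def extended_integral_def eq by (simp add: zero_ennreal.rep_eq)
qed

end

theory Submission
  imports Defs
begin

text \<open>For a fixed subgradient the infimum over admissible kernels equals the integral of \<open>v |y|\<^bsup>-d-s\<^esup>\<close>.

  Lower bound: by the layer cake formula, applied to the affine remainder \<open>w\<close> and to \<open>K\<close>, it is enough to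
  compare the measures of \<open>{K > m} - {w < l}\<close> and \<open>{|y|\<^bsup>-d-s\<^esup> > m} - {v < l}\<close>. Corresponding sets have
  the same measure, and the last two are nested, which minimises the measure of the difference.

  Upper bound: an optimal kernel need not exist, since \<open>{w < l}\<close> may have infinite measure for all \<open>l\<close>
  above some level. Fix \<open>q > 1\<close> and choose a kernel with \<open>{K > q\<^bsup>-k(d+s)\<^esup>} \<subseteq> {w < l\<^sub>k}\<close> for all integers
  \<open>k\<close>, where \<open>l\<^sub>k\<close> slightly exceeds the value of \<open>v\<close> at radius \<open>q\<^bsup>k\<^esup>\<close>; the excess leaves enough room in
  \<open>{w < l\<^sub>k}\<close>. Comparing the \<open>k\<close>-th shell of \<open>K\<close> with the next larger annulus gives the bound up to the
  factor \<open>q\<^bsup>d+2s\<^esup>\<close> and an arbitrarily small summand; then let \<open>q\<close> tend to 1.\<close>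

section \<open>Integer thresholds and the layer cake formula\<close>

text \<open>Otherwise stepping down from \<open>i\<close> never leaves \<open>P\<close> and passes
  below \<open>j\<close>. It finds the index at which a point enters an increasing chain of sets
  that is infinite in both directions.\<close>

lemma int_threshold:
  fixes P :: "int \<Rightarrow> bool"
  assumes "mono P" "P i" "\<not> P j"
  shows "\<exists>k. P (k + 1) \<and> \<not> P k"
proof (rule ccontr)
  assume no: "\<nexists>k. P (k + 1) \<and> \<not> P k"
  have "P (i - int n)" for n
  proof (induction n)
    case (Suc n)
    then show ?case using no by (metis add.commute add_diff_cancel_left' diff_add_cancel diff_diff_eq int_Suc plus_1_eq_Suc)
  qed (use assms in simp)
  then have "P (i - int (nat (i - j)))" .
  moreover have "i - int (nat (i - j)) \<le> j" by linarith
  ultimately show False using assms(1,3) by (auto simp: mono_def)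
qed

lemma emeasure_pos_le_ennreal:
  shows "emeasure lborel {t. 0 < t \<and> ennreal t \<le> a} = a"
    and "emeasure lborel {t. 0 < t \<and> ennreal t < a} = a"
proof -
  have top: "emeasure lborel {t::real. 0 < t} = \<infinity>"
  proof -
    have "emeasure lborel {0<..n} \<le> emeasure lborel {t::real. 0 < t}" for n :: real
      by (intro emeasure_mono) auto
    then have "ennreal (real n) \<le> emeasure lborel {t::real. 0 < t}" for n :: nat
      by (metis emeasure_lborel_Ioc diff_zero of_nat_0_le_iff)
    then show ?thesis
      by (metis ennreal_of_nat_eq_real_of_nat ennreal_SUP_of_nat_eq_top SUP_least infinity_ennreal_def neq_top_trans)
  qed
  show "emeasure lborel {t. 0 < t \<and> ennreal t \<le> a} = a"
  proof (cases a)
    case (real r)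
    then have "{t. 0 < t \<and> ennreal t \<le> a} = {0<..r}" by auto
    with real show ?thesis by simp
  qed (simp add: top)
  show "emeasure lborel {t. 0 < t \<and> ennreal t < a} = a"
  proof (cases a)
    case (real r)
    then have "{t. 0 < t \<and> ennreal t < a} = {0<..<r}" by (auto simp: ennreal_less_iff)
    with real show ?thesis by simp
  qed (simp add: top)
qed

text \<open>Fubini, after writing \<open>f y\<close> as the length of the set of \<open>t\<close>
  below it. Only \<open>f\<close> is sliced and \<open>g\<close> remains as a weight, so the formula
  can be applied again to the other factor. The weak slices are complements of sublevel sets as in
  \<open>radial_rearrangement\<close>, and the strict ones match the superlevel sets in
  \<open>admissible_kernel\<close>.\<close>

lemma (in sigma_finite_measure) nn_integral_layer_cake:
  assumes f[measurable]: "f \<in> borel_measurable M" and g[measurable]: "g \<in> borel_measurable M"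
  shows "(\<integral>\<^sup>+ y. f y * g y \<partial>M) = (\<integral>\<^sup>+ t. indicator {0<..} t * (\<integral>\<^sup>+ y. indicator {y. ennreal t \<le> f y} y * g y \<partial>M) \<partial>lborel)"
    and "(\<integral>\<^sup>+ y. f y * g y \<partial>M) = (\<integral>\<^sup>+ t. indicator {0<..} t * (\<integral>\<^sup>+ y. indicator {y. ennreal t < f y} y * g y \<partial>M) \<partial>lborel)"
proof -
  interpret pair_sigma_finite lborel M by unfold_locales
  have *: "f y * g y = (\<integral>\<^sup>+ t. indicator {t. 0 < t \<and> ennreal t \<le> f y} t * g y \<partial>lborel)"
          "f y * g y = (\<integral>\<^sup>+ t. indicator {t. 0 < t \<and> ennreal t < f y} t * g y \<partial>lborel)" for y
    by (simp_all add: nn_integral_multc emeasure_pos_le_ennreal)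
  have "(\<integral>\<^sup>+ y. f y * g y \<partial>M) = (\<integral>\<^sup>+ t. (\<integral>\<^sup>+ y. indicator {t. 0 < t \<and> ennreal t \<le> f y} t * g y \<partial>M) \<partial>lborel)"
    unfolding *(1) by (rule Fubini') measurable
  also have "\<dots> = (\<integral>\<^sup>+ t. indicator {0<..} t * (\<integral>\<^sup>+ y. indicator {y. ennreal t \<le> f y} y * g y \<partial>M) \<partial>lborel)"
    by (intro nn_integral_cong, subst nn_integral_cmult[symmetric]) (auto intro!: nn_integral_cong split: split_indicator)
  finally show "(\<integral>\<^sup>+ y. f y * g y \<partial>M) = (\<integral>\<^sup>+ t. indicator {0<..} t * (\<integral>\<^sup>+ y. indicator {y. ennreal t \<le> f y} y * g y \<partial>M) \<partial>lborel)" .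
  have "(\<integral>\<^sup>+ y. f y * g y \<partial>M) = (\<integral>\<^sup>+ t. (\<integral>\<^sup>+ y. indicator {t. 0 < t \<and> ennreal t < f y} t * g y \<partial>M) \<partial>lborel)"
    unfolding *(2) by (rule Fubini') measurable
  also have "\<dots> = (\<integral>\<^sup>+ t. indicator {0<..} t * (\<integral>\<^sup>+ y. indicator {y. ennreal t < f y} y * g y \<partial>M) \<partial>lborel)"
    by (intro nn_integral_cong, subst nn_integral_cmult[symmetric]) (auto intro!: nn_integral_cong split: split_indicator)
  finally show "(\<integral>\<^sup>+ y. f y * g y \<partial>M) = (\<integral>\<^sup>+ t. indicator {0<..} t * (\<integral>\<^sup>+ y. indicator {y. ennreal t < f y} y * g y \<partial>M) \<partial>lborel)" .
qed

lemma sigma_finite_lebesgue: "sigma_finite_measure (lebesgue :: 'a::euclidean_space measure)"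
proof (standard, intro exI conjI)
  let ?A = "range (\<lambda>n. ball (0::'a) (real n))"
  show "countable ?A" "?A \<subseteq> sets lebesgue" by auto
  show "\<Union> ?A = space lebesgue" by (auto simp: reals_Archimedean2)
  show "\<forall>a\<in>?A. emeasure lebesgue a \<noteq> \<infinity>"
    using emeasure_bounded_finite[OF bounded_ball] by (auto simp: less_top)
qed

section \<open>Monotonicity, measurability and value at the origin of a radial rearrangement\<close>

lemma radial_rearrangement_mono:
  assumes "radial_rearrangement w v" "norm y \<le> norm z"
  shows "v y \<le> v z"
proof (cases "z = 0")
  case False
  have radial: "\<And>y z. norm y = norm z \<Longrightarrow> v y = v z"
    and mono: "\<And>y t t'. 0 \<le> t \<Longrightarrow> t \<le> t' \<Longrightarrow> v (t *\<^sub>R y) \<le> v (t' *\<^sub>R y)"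
    using assms(1) unfolding radial_rearrangement_def by blast+
  have "v y = v ((norm y / norm z) *\<^sub>R z)"
    using False by (intro radial) simp
  also have "\<dots> \<le> v (1 *\<^sub>R z)"
    using assms(2) False by (intro mono) (auto simp: divide_le_eq_1)
  finally show ?thesis by simp
qed (use assms in simp)

text \<open>Measurability comes for free: \<open>v\<close> is a monotone function of the norm, and
  monotone real functions are Borel.\<close>

lemma radial_rearrangement_measurable:
  fixes v :: "'a::euclidean_space \<Rightarrow> real"
  assumes "radial_rearrangement w v"
  shows "v \<in> borel_measurable borel"
proof -
  obtain e :: 'a where e: "norm e = 1" using vector_choose_size zero_le_one by blast
  \<comment> \<open>Clamping at \<open>0\<close> keeps the profile monotone on the negative axis,
    where the norm of \<open>t *\<^sub>R e\<close> decreases.\<close>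
  define h where "h t = v (max 0 t *\<^sub>R e)" for t :: real
  have "mono h"
    unfolding h_def by (intro monoI radial_rearrangement_mono[OF assms]) (use e in simp)
  then have [measurable]: "h \<in> borel_measurable borel" by (rule borel_measurable_mono)
  have "v y = h (norm y)" for y
  proof -
    have "norm y = norm (max 0 (norm y) *\<^sub>R e)" using e by simp
    then show ?thesis using assms unfolding h_def radial_rearrangement_def by blast
  qed
  then have "v = (\<lambda>y. h (norm y))" ..
  then show ?thesis by simp
qed

text \<open>If \<open>v 0\<close> were positive, \<open>{v < v 0}\<close> would be empty by
  monotonicity and \<open>{w < v 0}\<close> null; but the latter is open and contains the
  origin.\<close>

lemma radial_rearrangement_zero:
  fixes w :: "'a::euclidean_space \<Rightarrow> real"
  assumes rr: "radial_rearrangement w v" and "continuous_on UNIV w" "w 0 = 0"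
  shows "v 0 = 0"
proof (rule ccontr)
  assume "v 0 \<noteq> 0"
  then have pos: "v 0 > 0" using rr unfolding radial_rearrangement_def by (metis order_less_le)
  have "{y. v y < v 0} = {}"
    using radial_rearrangement_mono[OF rr, of 0] by (auto simp: not_less)
  then have *: "emeasure lebesgue {y. w y < v 0} = 0"
    using rr pos unfolding radial_rearrangement_def by (metis emeasure_empty)
  have o: "open {y. w y < v 0}"
    using assms(2) by (intro open_Collect_less) (auto intro: continuous_intros)
  then have "negligible {y. w y < v 0}"
    using * by (simp add: negligible_iff_emeasure0)
  then have "{y. w y < v 0} = {}"
    using o open_not_negligible[of "{y. w y < v 0}"] by metis
  then have "\<not> w 0 < v 0" by blast
  then show False using pos assms(3) by simp
qed

section \<open>Lower bound: the integral against an arbitrary admissible kernel\<close>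

text \<open>The origin drops out because \<open>0 powr - a\<close> is \<open>0\<close> rather than
  infinite; this changes only a null set.\<close>

lemma superlevel_norm_powr:
  fixes a \<mu> :: real
  assumes "0 < a" "0 < \<mu>"
  shows "{y::'a::euclidean_space. ennreal \<mu> < ennreal (norm y powr - a)} = ball 0 (\<mu> powr (- 1 / a)) - {0}"
proof -
  have "\<mu> < norm y powr - a \<longleftrightarrow> norm y < \<mu> powr (- 1 / a)" if "y \<noteq> 0" for y :: 'a
  proof -
    have "norm y < \<mu> powr (- 1 / a) \<longleftrightarrow> (\<mu> powr (- 1 / a)) powr - a < norm y powr - a"
      using that assms powr_less_cancel_iff
      by (smt (verit) norm_ge_zero powr_gt_zero powr_less_mono2_neg zero_less_norm_iff)
    also have "(\<mu> powr (- 1 / a)) powr - a = \<mu>" using assms by (simp add: powr_powr)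
    finally show ?thesis by simp
  qed
  then have "\<mu> < norm y powr - a \<longleftrightarrow> y \<in> ball 0 (\<mu> powr (- 1 / a)) - {0}" for y :: 'a
    using assms by (cases "y = 0") auto
  moreover have "ennreal \<mu> < ennreal (norm y powr - a) \<longleftrightarrow> \<mu> < norm y powr - a" for y :: 'a
    using assms by (simp add: ennreal_less_iff)
  ultimately show ?thesis by blast
qed

lemma nn_integral_admissible_kernel_ge:
  fixes w v :: "'a::euclidean_space \<Rightarrow> real"
  assumes s: "0 < s" and K: "admissible_kernel s K" and rr: "radial_rearrangement w v"
    and w: "w \<in> borel_measurable lebesgue"
  shows "(\<integral>\<^sup>+ y. ennreal (v y) * ennreal (norm y powr (- real DIM('a) - s)) \<partial>lebesgue)
    \<le> (\<integral>\<^sup>+ y. ennreal (w y) * K y \<partial>lebesgue)"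
proof -
  interpret sigma_finite_measure "lebesgue :: 'a measure" by (rule sigma_finite_lebesgue)
  define k where "k y = ennreal (norm (y::'a) powr (- real DIM('a) - s))" for y
  note w [measurable]
  have [measurable]: "K \<in> borel_measurable lebesgue" using K unfolding admissible_kernel_def by blast
  have vb: "v \<in> borel_measurable borel" using rr by (rule radial_rearrangement_measurable)
  then have [measurable]: "v \<in> borel_measurable lebesgue" by (simp add: measurable_completion)
  have [measurable]: "k \<in> borel_measurable lebesgue"
    unfolding k_def by (intro measurable_completion) simp
  have double: "(\<integral>\<^sup>+ y. ennreal (f y) * g y \<partial>lebesgue) =
      (\<integral>\<^sup>+ l. indicator {0<..} l * (\<integral>\<^sup>+ m. indicator {0<..} m *
        emeasure lebesgue ({y. ennreal m < g y} - {y. f y < l}) \<partial>lborel) \<partial>lborel)"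
    if [measurable]: "f \<in> borel_measurable lebesgue" "g \<in> borel_measurable lebesgue" 
    for f :: "'a \<Rightarrow> real" and g
  proof -
    have "{y \<in> space lebesgue. ennreal m < g y \<and> \<not> f y < l} \<in> sets lebesgue" for m l
      by measurable
    then have meas: "{y. ennreal m < g y} - {y. f y < l} \<in> sets lebesgue" for m l
      by (simp add: set_diff_eq)
    have "(\<integral>\<^sup>+ y. indicator {y. ennreal l \<le> ennreal (f y)} y * g y \<partial>lebesgue) = 
        (\<integral>\<^sup>+ m. indicator {0<..} m * emeasure lebesgue ({y. ennreal m < g y} - {y. f y < l}) \<partial>lborel)" if "l > 0" for l
    proof -
      have "(\<integral>\<^sup>+ y. indicator {y. ennreal l \<le> ennreal (f y)} y * g y \<partial>lebesgue) =
        (\<integral>\<^sup>+ y. g y * indicator {y. ennreal l \<le> ennreal (f y)} y \<partial>lebesgue)" by (simp add: mult.commute)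
      also have "\<dots> = (\<integral>\<^sup>+ m. indicator {0<..} m * (\<integral>\<^sup>+ y. indicator {y. ennreal m < g y} y * indicator {y. ennreal l \<le> ennreal (f y)} y \<partial>lebesgue) \<partial>lborel)"
        by (rule nn_integral_layer_cake(2)) measurable
      \<comment> \<open>Since \<open>l > 0\<close>, the truncation of negative values of
        \<open>f\<close> by \<open>ennreal\<close> does not affect the slice.\<close>
      also have "(\<lambda>m. \<integral>\<^sup>+ y. indicator {y. ennreal m < g y} y * indicator {y. ennreal l \<le> ennreal (f y)} y \<partial>lebesgue)
        = (\<lambda>m. \<integral>\<^sup>+ y. indicator ({y. ennreal m < g y} - {y. f y < l}) y \<partial>lebesgue)"
        using that by (intro ext nn_integral_cong) (auto split: split_indicator simp: ennreal_le_iff2)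
      finally show ?thesis using nn_integral_indicator[OF meas] by simp
    qed
    then show ?thesis
      by (subst nn_integral_layer_cake(1)) (auto intro!: nn_integral_cong split: split_indicator)
  qed
  have "emeasure lebesgue ({y. ennreal m < k y} - {y. v y < l}) \<le> emeasure lebesgue ({y. ennreal m < K y} - {y. w y < l})"
    if "0 < l" "0 < m" for l m
  proof -
    \<comment> \<open>The radius at which the radial kernel takes the value
      \<open>m\<close>.\<close>
    define r where "r = m powr (- 1 / (real DIM('a) + s))"
    have r: "0 < r" using that by (simp add: r_def)
    have "- 1 / (real DIM('a) + s) * (- real DIM('a) - s) = 1"
      using s by (simp add: field_simps add_nonneg_eq_0_iff)
    then have rm: "r powr (- real DIM('a) - s) = m"
      using that by (simp only: r_def powr_powr) simp
    have Kr: "emeasure lebesgue {y. ennreal m < K y} = emeasure lebesgue (ball (0::'a) r)"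
      using K r rm unfolding admissible_kernel_def by metis
    have wv: "emeasure lebesgue {y. w y < l} = emeasure lebesgue {y. v y < l}"
      using rr that unfolding radial_rearrangement_def by blast
    have "{y \<in> space lebesgue. w y < l} \<in> sets lebesgue" "{y \<in> space lebesgue. v y < l} \<in> sets lebesgue"
      "{y \<in> space lebesgue. ennreal m < K y} \<in> sets lebesgue"
      by measurable
    then have ms: "{y. w y < l} \<in> sets lebesgue" "{y. v y < l} \<in> sets lebesgue" "{y. ennreal m < K y} \<in> sets lebesgue"
      by simp_all
    have mb: "ball (0::'a) r \<in> sets lebesgue" by simp
    have fin: "emeasure lebesgue (ball (0::'a) r) < \<infinity>"
      using emeasure_bounded_finite[OF bounded_ball, of "0::'a" r] by simp
    have "{y. ennreal m < k y} = ball 0 r - {0}"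
      using superlevel_norm_powr[of "real DIM('a) + s" m] s that unfolding k_def r_def by simp
    then have "{y. ennreal m < k y} - {y. v y < l} \<subseteq> ball 0 r - {y. v y < l}" by blast
    then have "emeasure lebesgue ({y. ennreal m < k y} - {y. v y < l}) \<le> emeasure lebesgue (ball 0 r - {y. v y < l})"
      using ms(2) mb by (intro emeasure_mono sets.Diff)
    \<comment> \<open>Nestedness enters here: either the difference is empty, or the sublevel set of
      \<open>v\<close> lies in the ball, has finite measure and can be subtracted exactly.\<close>
    also have "\<dots> \<le> emeasure lebesgue (ball (0::'a) r) - emeasure lebesgue {y. v y < l}"
    proof (cases "ball 0 r \<subseteq> {y. v y < l}")
      case True
      then have empty: "ball 0 r - {y. v y < l} = {}" by blast
      show ?thesis unfolding empty by simp
    next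
      case False
      then obtain z where "z \<in> ball 0 r" "\<not> v z < l" by blast
      then have z: "norm z < r" "l \<le> v z" by simp_all
      have sub: "{y. v y < l} \<subseteq> ball 0 r"
      proof
        fix y assume "y \<in> {y. v y < l}"
        then have "\<not> norm z \<le> norm y" using radial_rearrangement_mono[OF rr, of z y] z by auto
        then show "y \<in> ball 0 r" using z by simp
      qed
      then have "emeasure lebesgue {y. v y < l} \<noteq> \<infinity>"
        using emeasure_mono[OF sub mb] fin by (auto simp: less_top top_unique)
      from emeasure_Diff[OF this mb ms(2) sub] show ?thesis by (rule eq_refl)
    qed
    also have "\<dots> = emeasure lebesgue {y. ennreal m < K y} - emeasure lebesgue {y. w y < l}"
      by (simp only: Kr wv)
    \<comment> \<open>For sets in arbitrary position subadditivity still gives this direction; the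
      finite measure of the ball permits the subtraction.\<close>
    also have "\<dots> \<le> emeasure lebesgue ({y. ennreal m < K y} - {y. w y < l})"
    proof -
      have "emeasure lebesgue {y. ennreal m < K y} \<le> emeasure lebesgue (({y. ennreal m < K y} - {y. w y < l}) \<union> {y. w y < l})"
        using ms by (intro emeasure_mono sets.Un sets.Diff) blast+
      also have "\<dots> \<le> emeasure lebesgue ({y. ennreal m < K y} - {y. w y < l}) + emeasure lebesgue {y. w y < l}"
        using ms by (intro emeasure_subadditive sets.Diff)
      finally show ?thesis using fin unfolding Kr[symmetric] by (auto simp: ennreal_minus_le_iff add.commute)
    qed
    finally show ?thesis .
  qed
  then have "(\<integral>\<^sup>+ y. ennreal (v y) * k y \<partial>lebesgue) \<le> (\<integral>\<^sup>+ y. ennreal (w y) * K y \<partial>lebesgue)"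
    by (subst (1 2) double) (auto intro!: nn_integral_mono split: split_indicator)
  then show ?thesis by (simp add: k_def)
qed

section \<open>Sets of prescribed measure\<close>

text \<open>An intermediate value argument: finite measures and null level sets make the
  distribution function \<open>g\<close> continuous. The level is the least one reaching
  \<open>t\<close>, which gives the strict inequality below it; the construction of a kernel relies
  on this minimality.\<close>

lemma sublevel_of_given_measure:
  fixes \<phi> :: "'b \<Rightarrow> real"
  assumes S [measurable]: "S \<in> sets M" and \<phi> [measurable]: "\<phi> \<in> borel_measurable M"
    and fin: "\<And>a. emeasure M {y\<in>S. \<phi> y < a} \<noteq> \<infinity>"
    and null: "\<And>a. emeasure M {y\<in>S. \<phi> y = a} = 0"
    and t: "0 < t" "t \<le> emeasure M {y\<in>S. \<phi> y < a0}"
  obtains a where "emeasure M {y\<in>S. \<phi> y < a} = t" "\<And>a'. a' < a \<Longrightarrow> emeasure M {y\<in>S. \<phi> y < a'} < t"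
proof -
  define g where "g a = emeasure M {y\<in>S. \<phi> y < a}" for a
  have SS: "S \<subseteq> space M" using S sets.sets_into_space by blast
  have eqs: "{y\<in>S. \<phi> y < a} = {y\<in>space M. \<phi> y < a} \<inter> S" "{y\<in>S. \<phi> y \<le> a} = {y\<in>space M. \<phi> y \<le> a} \<inter> S"
    "{y\<in>S. \<phi> y = a} = {y\<in>space M. \<phi> y = a} \<inter> S" for a
    using SS by auto
  have m [measurable]: "{y\<in>S. \<phi> y < a} \<in> sets M" "{y\<in>S. \<phi> y \<le> a} \<in> sets M" "{y\<in>S. \<phi> y = a} \<in> sets M" for a
    unfolding eqs by measurable
  have mono: "g a \<le> g b" if "a \<le> b" for a b
    unfolding g_def using that by (intro emeasure_mono) auto
  define T where "T = {a. t \<le> g a}"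
  have ne: "a0 \<in> T" using t by (simp add: T_def g_def)
  \<comment> \<open>The sublevel sets shrink to the empty set at minus infinity, so
    \<open>t > 0\<close> bounds \<open>T\<close> from below.\<close>
  have "\<exists>n. g (- real n) < t"
  proof -
    have "(\<lambda>n. emeasure M {y\<in>S. \<phi> y < - real n}) \<longlonglongrightarrow> emeasure M (\<Inter>n. {y\<in>S. \<phi> y < - real n})"
      using m fin by (intro Lim_emeasure_decseq) (auto simp: decseq_def)
    moreover have "(\<Inter>n. {y\<in>S. \<phi> y < - real n}) = {}"
    proof (intro equals0I)
      fix y assume y: "y \<in> (\<Inter>n. {y\<in>S. \<phi> y < - real n})"
      obtain n where "- \<phi> y < real n" using reals_Archimedean2 by blast
      moreover have "\<phi> y < - real n" using y by blast
      ultimately show False by simp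
    qed
    ultimately have "(\<lambda>n. g (- real n)) \<longlonglongrightarrow> 0" by (simp add: g_def)
    from order_tendstoD(2)[OF this t(1)] show ?thesis by (auto simp: eventually_sequentially)
  qed
  then obtain n where n: "g (- real n) < t" ..
  have bdd: "bdd_below T"
  proof (intro bdd_belowI)
    fix a assume "a \<in> T"
    then have "t \<le> g a" by (simp add: T_def)
    with n have "\<not> g a \<le> g (- real n)" by (meson le_less_trans leD)
    with mono[of a "- real n"] show "- real n \<le> a" by linarith
  qed
  define \<tau> where "\<tau> = Inf T"
  have below: "g a < t" if "a < \<tau>" for a
  proof (rule ccontr)
    assume "\<not> g a < t"
    then have "a \<in> T" by (simp add: T_def not_less)
    from cInf_lower[OF this bdd] that show False by (simp add: \<tau>_def)
  qed
  have above: "t \<le> g a" if "\<tau> < a" for a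
  proof -
    have "T \<noteq> {}" using ne by blast
    from cInf_lessD[OF this that[unfolded \<tau>_def]] obtain b where "t \<le> g b" "b < a"
      by (auto simp: T_def)
    then show ?thesis using mono[of b a] by (simp add: less_imp_le order_trans)
  qed
  define h where "h n = inverse (real (Suc n))" for n
  have h_pos: "0 < h n" and h_dec: "h (Suc n) \<le> h n" for n
    unfolding h_def by (simp, rule le_imp_inverse_le) auto
  have h_arch: "\<exists>n. h n < e" if "0 < e" for e
    using reals_Archimedean[OF that] by (simp add: h_def)
  have "g \<tau> \<le> t"
  proof -
    have "(\<lambda>n. emeasure M {y\<in>S. \<phi> y < \<tau> - h n}) \<longlonglongrightarrow> emeasure M (\<Union>n. {y\<in>S. \<phi> y < \<tau> - h n})"
    proof (intro Lim_emeasure_incseq incseq_SucI)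
      show "{y\<in>S. \<phi> y < \<tau> - h n} \<subseteq> {y\<in>S. \<phi> y < \<tau> - h (Suc n)}" for n
        using h_dec[of n] by auto
    qed (use m in auto)
    moreover have "(\<Union>n. {y\<in>S. \<phi> y < \<tau> - h n}) = {y\<in>S. \<phi> y < \<tau>}"
    proof safe
      fix y n assume "\<phi> y < \<tau> - h n"
      then show "\<phi> y < \<tau>" using h_pos[of n] by linarith
    next
      fix y assume "\<phi> y < \<tau>" "y \<in> S"
      then obtain n where "h n < \<tau> - \<phi> y" using h_arch[of "\<tau> - \<phi> y"] by auto
      then show "y \<in> (\<Union>n. {y\<in>S. \<phi> y < \<tau> - h n})" using \<open>y \<in> S\<close> by (auto intro!: exI[of _ n])
    qed
    ultimately have "(\<lambda>n. g (\<tau> - h n)) \<longlonglongrightarrow> g \<tau>" by (simp add: g_def)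
    then show ?thesis
      by (rule LIMSEQ_le_const2) (intro exI[of _ 0] allI impI less_imp_le below, use h_pos in simp)
  qed
  \<comment> \<open>From the right the limit is the measure of \<open>{\<phi> \<le> \<tau>}\<close>,
    which exceeds \<open>g \<tau>\<close> only by a null level set.\<close>
  moreover have "t \<le> g \<tau>"
  proof -
    have "(\<lambda>n. emeasure M {y\<in>S. \<phi> y < \<tau> + h n}) \<longlonglongrightarrow> emeasure M (\<Inter>n. {y\<in>S. \<phi> y < \<tau> + h n})"
    proof (intro Lim_emeasure_decseq decseq_SucI)
      show "{y\<in>S. \<phi> y < \<tau> + h (Suc n)} \<subseteq> {y\<in>S. \<phi> y < \<tau> + h n}" for n
        using h_dec[of n] by auto
    qed (use m fin in auto)
    moreover have "(\<Inter>n. {y\<in>S. \<phi> y < \<tau> + h n}) = {y\<in>S. \<phi> y \<le> \<tau>}"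
    proof safe
      fix y assume y: "y \<in> (\<Inter>n. {y\<in>S. \<phi> y < \<tau> + h n})"
      show "\<phi> y \<le> \<tau>"
      proof (rule ccontr)
        assume "\<not> \<phi> y \<le> \<tau>"
        then obtain n where "h n < \<phi> y - \<tau>" using h_arch[of "\<phi> y - \<tau>"] by auto
        moreover have "\<phi> y < \<tau> + h n" using y by blast
        ultimately show False by simp
      qed
    next
      fix y n assume "\<phi> y \<le> \<tau>"
      then show "\<phi> y < \<tau> + h n" using h_pos[of n] by linarith
    qed auto
    ultimately have "(\<lambda>n. g (\<tau> + h n)) \<longlonglongrightarrow> emeasure M {y\<in>S. \<phi> y \<le> \<tau>}" by (simp add: g_def)
    then have "t \<le> emeasure M {y\<in>S. \<phi> y \<le> \<tau>}"
      by (rule LIMSEQ_le_const) (intro exI[of _ 0] allI impI above, use h_pos in simp)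
    also have "\<dots> \<le> emeasure M ({y\<in>S. \<phi> y < \<tau>} \<union> {y\<in>S. \<phi> y = \<tau>})"
      by (intro emeasure_mono) auto
    also have "\<dots> \<le> g \<tau> + 0"
      unfolding g_def null[of \<tau>, symmetric] by (intro emeasure_subadditive) auto
    finally show ?thesis by simp
  qed
  ultimately have "g \<tau> = t" by (rule antisym)
  then show ?thesis using that[of \<tau>] below unfolding g_def by blast
qed

lemma emeasure_lebesgue_sphere: "emeasure lebesgue (sphere (c::'a::euclidean_space) r) = 0"
  using negligible_sphere by (simp add: negligible_iff_emeasure0)

text \<open>Cut \<open>A\<close> by a centred ball of suitable radius: spheres are null, so the
  preceding lemma applies to the norm. When \<open>A\<close> has measure exactly \<open>t\<close>,
  no bounded ball need suffice, and \<open>A\<close> itself is taken.\<close>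

lemma lebesgue_subset_of_given_measure:
  fixes A :: "'a::euclidean_space set"
  assumes A [measurable]: "A \<in> sets lebesgue" and t: "0 < t" "t \<noteq> \<infinity>" "t \<le> emeasure lebesgue A"
  obtains C where "C \<in> sets lebesgue" "C \<subseteq> A" "emeasure lebesgue C = t"
proof (cases "emeasure lebesgue A = t")
  case False
  with t have less: "t < emeasure lebesgue A" by simp
  have eq: "{y\<in>A. norm y < a} = A \<inter> ball 0 a" for a by auto
  have "(\<lambda>n. emeasure lebesgue (A \<inter> ball 0 (real n))) \<longlonglongrightarrow> emeasure lebesgue (\<Union>n. A \<inter> ball 0 (real n))"
    by (intro Lim_emeasure_incseq) (auto simp: incseq_def)
  moreover have "(\<Union>n. A \<inter> ball 0 (real n)) = A" by (auto simp: reals_Archimedean2)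
  ultimately have "(\<lambda>n. emeasure lebesgue {y\<in>A. norm y < real n}) \<longlonglongrightarrow> emeasure lebesgue A" by (simp add: eq)
  from order_tendstoD(1)[OF this less] obtain n where n: "t < emeasure lebesgue {y\<in>A. norm y < real n}"
    by (auto simp: eventually_sequentially)
  have fin: "emeasure lebesgue {y\<in>A. norm y < a} \<noteq> \<infinity>" for a
  proof -
    have "emeasure lebesgue (A \<inter> ball 0 a) \<le> emeasure lebesgue (ball (0::'a) a)"
      by (rule emeasure_mono) auto
    also have "\<dots> < \<infinity>"
      using emeasure_bounded_finite[OF bounded_ball, of "0::'a" a] by simp
    finally show ?thesis by (simp add: eq)
  qed
  have null: "emeasure lebesgue {y\<in>A. norm y = a} = 0" for a
  proof -
    have "emeasure lebesgue {y\<in>A. norm y = a} \<le> emeasure lebesgue (sphere (0::'a) a)"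
      by (rule emeasure_mono) auto
    then show ?thesis by (simp add: emeasure_lebesgue_sphere)
  qed
  have "norm \<in> borel_measurable (lebesgue :: 'a measure)"
    by (intro measurable_completion) simp
  from sublevel_of_given_measure[OF A this fin null t(1) less_imp_le[OF n]]
  obtain a where "emeasure lebesgue {y\<in>A. norm y < a} = t" by blast
  moreover have "A \<inter> ball 0 a \<in> sets lebesgue" by (intro sets.Int A) simp
  ultimately show ?thesis using that[of "A \<inter> ball 0 a"] unfolding eq by blast
qed (use that[of A] in auto)

section \<open>Admissible kernels with superlevel sets inside given sets\<close>

text \<open>The superlevel sets of the kernel are initial segments of an ordering in which each
  \<open>L k\<close> precedes the rest of \<open>S\<close>. By \<open>big\<close>, the segment with
  the volume of \<open>ball 0 (b k)\<close> is used up inside \<open>L k\<close>; unboundedness of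
  \<open>b\<close> leaves room for every radius.\<close>

lemma admissible_kernel_of_nested_sets:
  fixes L :: "int \<Rightarrow> 'a::euclidean_space set" and b :: "int \<Rightarrow> real"
  assumes s: "0 < s"
    and L [measurable]: "\<And>k. L k \<in> sets lebesgue" and mono: "mono L"
    and fin: "\<And>k. emeasure lebesgue (L k) \<noteq> \<infinity>"
    and small: "\<And>e. 0 < e \<Longrightarrow> \<exists>k. emeasure lebesgue (L k) < e"
    and b: "\<And>k. 0 < b k" "\<And>r. \<exists>k. r \<le> b k"
    and big: "\<And>k. emeasure lebesgue (ball (0::'a) (b k)) \<le> emeasure lebesgue (L k)"
  obtains K where "admissible_kernel s K"
    "\<And>k. {y. ennreal (b k powr (- real DIM('a) - s)) < K y} \<subseteq> L k"
proof -
  \<comment> \<open>Points of \<open>N\<close> have no index of entry into the chain;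
    \<open>small\<close> makes \<open>N\<close> null. Points of \<open>S\<close> have one.\<close>
  define N where "N = (\<Inter>k. L k)"
  define S where "S = (\<Union>k. L k) - N"
  have [measurable]: "N \<in> sets lebesgue" "S \<in> sets lebesgue" unfolding S_def N_def by measurable
  have N0: "emeasure lebesgue N = 0"
  proof (rule ccontr)
    assume "emeasure lebesgue N \<noteq> 0"
    then have "0 < emeasure lebesgue N" by (simp add: zero_less_iff_neq_zero)
    then obtain k where "emeasure lebesgue (L k) < emeasure lebesgue N" using small by blast
    moreover have "emeasure lebesgue N \<le> emeasure lebesgue (L k)" by (intro emeasure_mono) (auto simp: N_def)
    ultimately show False by simp
  qed
  have LS: "emeasure lebesgue (L k \<inter> S) = emeasure lebesgue (L k)" for k
  proof -
    have "L k \<inter> S = L k - N" by (auto simp: S_def)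
    then show ?thesis using N0 by (simp add: emeasure_Diff_null_set null_setsI)
  qed
  have "\<exists>k. y \<in> L (k + 1) \<and> y \<notin> L k" if y: "y \<in> S" for y
  proof -
    obtain i j where "y \<in> L i" "y \<notin> L j" using y unfolding S_def N_def by blast
    moreover have "mono (\<lambda>k. y \<in> L k)" using mono by (auto simp: mono_def)
    ultimately show ?thesis using int_threshold[of "\<lambda>k. y \<in> L k"] by blast
  qed
  then obtain \<kappa> where \<kappa>: "\<And>y. y \<in> S \<Longrightarrow> y \<in> L (\<kappa> y + 1) \<and> y \<notin> L (\<kappa> y)" by metis
  have \<kappa>_iff: "y \<in> L k \<longleftrightarrow> \<kappa> y < k" if "y \<in> S" for y k
  proof
    assume "y \<in> L k"
    show "\<kappa> y < k"
    proof (rule ccontr)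
      assume "\<not> \<kappa> y < k"
      then have "L k \<subseteq> L (\<kappa> y)" using mono by (simp add: mono_def)
      then show False using \<kappa>[OF that] \<open>y \<in> L k\<close> by blast
    qed
  next
    assume "\<kappa> y < k"
    then have "L (\<kappa> y + 1) \<subseteq> L k" using mono by (simp add: mono_def)
    then show "y \<in> L k" using \<kappa>[OF that] by blast
  qed
  \<comment> \<open>The points of \<open>S\<close> are ordered lexicographically by the index of the first \<open>L k\<close> containing them and
    by their norm; \<open>K\<close> at \<open>y\<close> is the radial kernel on the sphere enclosing the volume of the predecessors of \<open>y\<close>.\<close>
  define \<theta> where "\<theta> y = norm y / (1 + norm y)" for y :: 'a
  have \<theta>: "0 \<le> \<theta> y" "\<theta> y < 1" for y by (auto simp: \<theta>_def divide_less_eq add_pos_nonneg)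
  have [measurable]: "\<theta> \<in> borel_measurable lebesgue" unfolding \<theta>_def by (intro measurable_completion) simp
  \<comment> \<open>On \<open>S\<close>, comparing \<open>\<phi> y\<close> with an integer depends
    on \<open>\<kappa> y\<close> alone because \<open>\<theta> y < 1\<close>, and the fractional
    part recovers the norm.\<close>
  define \<phi> where "\<phi> y = (if y \<in> S then of_int (\<kappa> y) + \<theta> y else 0)" for y
  have \<phi>_less: "\<phi> y < of_int k \<longleftrightarrow> y \<in> L k" if "y \<in> S" for y k
    using \<kappa>_iff[OF that, of k] \<theta>[of y] that unfolding \<phi>_def by (simp, linarith)
  \<comment> \<open>The function \<open>\<kappa>\<close> was obtained by choice, so measurability is
    reached through the countably many shells on which it is constant.\<close>
  have "{y\<in>S. \<phi> y < a} = (\<Union>k. {y\<in>space lebesgue. of_int k + \<theta> y < a} \<inter> S \<inter> (L (k + 1) - L k))" for a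
  proof safe
    fix y assume y: "\<phi> y < a" "y \<in> S"
    then show "y \<in> (\<Union>k. {y\<in>space lebesgue. of_int k + \<theta> y < a} \<inter> S \<inter> (L (k + 1) - L k))"
      using \<kappa>[OF y(2)] by (intro UN_I[of "\<kappa> y"]) (auto simp: \<phi>_def)
  next
    fix y k assume y: "y \<in> S" "y \<in> L (k + 1)" "y \<notin> L k" "of_int k + \<theta> y < a"
    then have "\<kappa> y = k" using \<kappa>_iff[OF y(1)] by fastforce
    then show "\<phi> y < a" using y by (simp add: \<phi>_def)
  qed
  then have sub_meas: "{y\<in>S. \<phi> y < a} \<in> sets lebesgue" for a by simp
  have \<phi>_meas [measurable]: "\<phi> \<in> borel_measurable lebesgue"
  proof (subst borel_measurable_iff_less, intro allI)
    fix a
    have "{y \<in> space lebesgue. \<phi> y < a} = {y\<in>S. \<phi> y < a} \<union> (if 0 < a then space lebesgue - S else {})"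
      by (auto simp: \<phi>_def)
    also have "\<dots> \<in> sets lebesgue"
      using sets.Un[OF sub_meas[of a] sets.compl_sets[OF \<open>S \<in> sets lebesgue\<close>]] sub_meas[of a] by simp
    finally show "{y \<in> space lebesgue. \<phi> y < a} \<in> sets lebesgue" .
  qed
  define g where "g a = emeasure lebesgue {y\<in>S. \<phi> y < a}" for a
  have g_fin: "g a \<noteq> \<infinity>" for a
  proof -
    have "g a \<le> emeasure lebesgue (L (ceiling a))"
      unfolding g_def
    proof (intro emeasure_mono subsetI)
      fix y assume "y \<in> {y\<in>S. \<phi> y < a}"
      then show "y \<in> L (ceiling a)" using \<phi>_less[of y "ceiling a"] by (auto intro: less_le_trans[OF _ le_of_int_ceiling])
    qed simp
    then show ?thesis using fin[of "ceiling a"] by (auto simp: top_unique)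
  qed
  have null: "emeasure lebesgue {y\<in>S. \<phi> y = a} = 0" for a
  proof -
    \<comment> \<open>The radius solves \<open>t / (1 + t) = frac a\<close>.\<close>
    have "{y\<in>S. \<phi> y = a} \<subseteq> sphere 0 (frac a / (1 - frac a))"
    proof
      fix y assume y: "y \<in> {y\<in>S. \<phi> y = a}"
      then have "frac a = \<theta> y" using \<theta>[of y] by (auto simp: \<phi>_def frac_unique_iff)
      moreover have "1 - \<theta> y = 1 / (1 + norm y)"
        by (simp add: \<theta>_def field_simps add_pos_nonneg add_nonneg_eq_0_iff)
      moreover have "1 + norm y \<noteq> 0" by (smt (verit) norm_ge_zero)
      ultimately show "y \<in> sphere 0 (frac a / (1 - frac a))" by (simp add: \<theta>_def)
    qed
    then have "emeasure lebesgue {y\<in>S. \<phi> y = a} \<le> emeasure lebesgue (sphere (0::'a) (frac a / (1 - frac a)))"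
      by (intro emeasure_mono) auto
    then show ?thesis by (simp add: emeasure_lebesgue_sphere)
  qed
  have g_int: "g (of_int k) = emeasure lebesgue (L k)" for k
  proof -
    have "{y\<in>S. \<phi> y < of_int k} = L k \<inter> S" using \<phi>_less by auto
    then show ?thesis by (simp add: g_def LS)
  qed
  have g_mono: "g a \<le> g c" if "a \<le> c" for a c
    unfolding g_def using that sub_meas by (intro emeasure_mono) auto
  define \<omega> where "\<omega> = unit_ball_vol DIM('a)"
  have \<omega>: "0 < \<omega>" by (simp add: \<omega>_def)
  define G where "G a = enn2real (g a)" for a
  have gG: "g a = ennreal (G a)" for a using g_fin[of a] by (simp add: G_def less_top)
  have G0: "0 \<le> G a" for a by (simp add: G_def)
  have G_mono: "mono G" using g_mono G0 by (auto simp: mono_def gG)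
  have [measurable]: "G \<in> borel_measurable borel" using G_mono by (rule borel_measurable_mono)
  \<comment> \<open>The radius of the ball whose volume is that of the predecessors of
    \<open>y\<close>.\<close>
  define \<rho> where "\<rho> y = root DIM('a) (G (\<phi> y) / \<omega>)" for y
  \<comment> \<open>At \<open>\<rho> y = 0\<close> the formula would give \<open>0\<close>, so the
    value \<open>top\<close> is set by hand.\<close>
  define K where "K y = (if y \<in> S then (if \<rho> y = 0 then top else ennreal (\<rho> y powr (- real DIM('a) - s))) else 0)" for y
  have [measurable]: "\<rho> \<in> borel_measurable lebesgue" unfolding \<rho>_def by measurable
  have K_meas: "K \<in> borel_measurable lebesgue" unfolding K_def by measurable
  have \<rho>0: "0 \<le> \<rho> y" for y using G0 \<omega> by (simp add: \<rho>_def)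
  have superlevel: "{y. ennreal (r powr (- real DIM('a) - s)) < K y} = {y\<in>S. g (\<phi> y) < emeasure lebesgue (ball (0::'a) r)}"
    if r: "0 < r" for r
  proof -
    have "ennreal (r powr (- real DIM('a) - s)) < K y \<longleftrightarrow> \<rho> y < r" if "y \<in> S" for y
    proof (cases "\<rho> y = 0")
      case False
      then have "0 < \<rho> y" using \<rho>0[of y] by simp
      then have "r powr (- real DIM('a) - s) < \<rho> y powr (- real DIM('a) - s) \<longleftrightarrow> \<rho> y < r"
        using r s by (smt (verit) of_nat_0_le_iff powr_less_mono2_neg)
      then show ?thesis using False that by (simp add: K_def ennreal_less_iff)
    qed (use r that in \<open>simp add: K_def\<close>)
    moreover have "\<rho> y < r \<longleftrightarrow> g (\<phi> y) < emeasure lebesgue (ball (0::'a) r)" for y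
    proof -
      have "\<rho> y < r \<longleftrightarrow> \<rho> y ^ DIM('a) < r ^ DIM('a)"
        using power_mono_iff[OF less_imp_le[OF r] \<rho>0[of y] DIM_positive[where 'a='a]] by auto
      also have "\<rho> y ^ DIM('a) = G (\<phi> y) / \<omega>" using G0 \<omega> by (simp add: \<rho>_def)
      also have "G (\<phi> y) / \<omega> < r ^ DIM('a) \<longleftrightarrow> G (\<phi> y) < \<omega> * r ^ DIM('a)"
        using \<omega> by (simp add: field_simps)
      finally show ?thesis using r G0 by (simp add: emeasure_ball gG \<omega>_def ennreal_less_iff)
    qed
    ultimately show ?thesis by (auto simp: K_def)
  qed
  have "emeasure lebesgue {y. ennreal (r powr (- real DIM('a) - s)) < K y} = emeasure lebesgue (ball (0::'a) r)"
    if r: "0 < r" for r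
  proof -
    have fr: "0 < emeasure lebesgue (ball (0::'a) r)"
      using r \<omega> by (simp add: emeasure_ball \<omega>_def)
    obtain k where "r \<le> b k" using b by blast
    then have "emeasure lebesgue (ball (0::'a) r) \<le> emeasure lebesgue (ball (0::'a) (b k))"
      by (intro emeasure_mono) auto
    also have "\<dots> \<le> g (of_int k)" using big by (simp add: g_int)
    finally have le: "emeasure lebesgue (ball (0::'a) r) \<le> emeasure lebesgue {y\<in>S. \<phi> y < of_int k}" by (simp add: g_def)
    obtain a where "emeasure lebesgue {y\<in>S. \<phi> y < a} = emeasure lebesgue (ball (0::'a) r)"
      "\<And>a'. a' < a \<Longrightarrow> emeasure lebesgue {y\<in>S. \<phi> y < a'} < emeasure lebesgue (ball (0::'a) r)"
      by (rule sublevel_of_given_measure[OF \<open>S \<in> sets lebesgue\<close> \<phi>_meas g_fin[unfolded g_def] null fr le]) blast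
    note a = this[folded g_def]
    \<comment> \<open>Since \<open>g\<close> may be constant on intervals, the inclusion from right
      to left needs \<open>a\<close> to be the least level with this measure.\<close>
    have "{y\<in>S. g (\<phi> y) < emeasure lebesgue (ball (0::'a) r)} = {y\<in>S. \<phi> y < a}"
    proof (intro Collect_cong conj_cong refl iffI)
      fix y assume less: "g (\<phi> y) < emeasure lebesgue (ball (0::'a) r)"
      show "\<phi> y < a"
      proof (rule ccontr)
        assume "\<not> \<phi> y < a"
        then have "g a \<le> g (\<phi> y)" by (simp add: g_mono not_less)
        with less a(1) show False by simp
      qed
    qed (rule a(2))
    then show ?thesis using a(1) by (simp add: superlevel[OF r] g_def)
  qed
  then have "admissible_kernel s K" using K_meas unfolding admissible_kernel_def by blast
  moreover have "{y. ennreal (b k powr (- real DIM('a) - s)) < K y} \<subseteq> L k" for k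
  proof
    fix y assume "y \<in> {y. ennreal (b k powr (- real DIM('a) - s)) < K y}"
    then have y: "y \<in> S" "g (\<phi> y) < emeasure lebesgue (ball (0::'a) (b k))" using superlevel[OF b(1)[of k]] by auto
    then have "g (\<phi> y) < g (of_int k)" using big[of k] by (simp add: g_int)
    then have "\<not> g (of_int k) \<le> g (\<phi> y)" by simp
    then have "\<phi> y < of_int k" using g_mono[of "of_int k" "\<phi> y"] by linarith
    then show "y \<in> L k" using y \<phi>_less by blast
  qed
  ultimately show ?thesis by (rule that)
qed

text \<open>Reduction to the preceding lemma: each \<open>A k\<close> is shrunk to a set
  \<open>C k\<close> with the volume of the ball. The \<open>C k\<close> need not be nested, so they
  are united over all lower indices, which stays inside \<open>A k\<close> by monotonicity.\<close>

lemma admissible_kernel_superlevels_subset: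
  fixes A :: "int \<Rightarrow> 'a::euclidean_space set"
  assumes s: "0 < s" and q: "1 < q"
    and A: "\<And>k. A k \<in> sets lebesgue" and mono: "mono A"
    and big: "\<And>k. emeasure lebesgue (ball (0::'a) (q powr of_int k)) \<le> emeasure lebesgue (A k)"
  obtains K where "admissible_kernel s K"
    "\<And>k. {y. ennreal ((q powr of_int k) powr (- real DIM('a) - s)) < K y} \<subseteq> A k"
proof -
  let ?b = "\<lambda>k. q powr of_int k"
  define \<omega> where "\<omega> = unit_ball_vol DIM('a)"
  have \<omega>: "0 < \<omega>" by (simp add: \<omega>_def)
  have ball: "emeasure lebesgue (ball (0::'a) (?b k)) = ennreal (\<omega> * ?b k ^ DIM('a))" for k
    using q by (simp add: emeasure_ball \<omega>_def)
  have "\<exists>C. C \<in> sets lebesgue \<and> C \<subseteq> A k \<and> emeasure lebesgue C = emeasure lebesgue (ball (0::'a) (?b k))" for k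
  proof -
    have "0 < emeasure lebesgue (ball (0::'a) (?b k))" "emeasure lebesgue (ball (0::'a) (?b k)) \<noteq> \<infinity>"
      unfolding ball using q \<omega> by simp_all
    from lebesgue_subset_of_given_measure[OF A this big] show ?thesis by metis
  qed
  then obtain C where C: "\<And>k. C k \<in> sets lebesgue" "\<And>k. C k \<subseteq> A k" 
    "\<And>k. emeasure lebesgue (C k) = emeasure lebesgue (ball (0::'a) (?b k))" by metis
  \<comment> \<open>The sets \<open>A k\<close> may all have infinite measure, whereas \<open>L k\<close> is bounded by a geometric series.\<close>
  define L where "L k = (\<Union>n. C (k - int n))" for k
  have [measurable]: "L k \<in> sets lebesgue" for k unfolding L_def using C by auto
  have L_le: "L k = (\<Union>j\<in>{..k}. C j)" for k
  proof -
    have "\<exists>n. j = k - int n" if "j \<le> k" for j using that by (intro exI[of _ "nat (k - j)"]) simp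
    then show ?thesis unfolding L_def by fastforce
  qed
  have "mono L" unfolding L_le by (intro monoI UN_mono) auto
  have LA: "L k \<subseteq> A k" for k unfolding L_le
  proof (intro UN_least)
    fix j assume "j \<in> {..k}"
    then show "C j \<subseteq> A k" using C(2)[of j] monoD[OF mono, of j k] by simp
  qed
  have CL: "C k \<subseteq> L k" for k unfolding L_le by auto
  \<comment> \<open>The volume ratio of consecutive balls as the index decreases.\<close>
  define x where "x = inverse (q ^ DIM('a))"
  have x: "0 < x" "x < 1" using q by (auto simp: x_def inverse_less_1_iff one_less_power)
  have pw: "?b (k - int n) ^ DIM('a) = ?b k ^ DIM('a) * x ^ n" for k n
  proof -
    have "?b (k - int n) = ?b k * inverse (q ^ n)"
      using q by (simp add: powr_diff powr_realpow divide_inverse)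
    then show ?thesis by (simp add: x_def power_mult_distrib power_inverse flip: power_mult) (simp add: mult.commute)
  qed
  have L_bound: "emeasure lebesgue (L k) \<le> ennreal (\<omega> * ?b k ^ DIM('a) / (1 - x))" for k
  proof -
    have "emeasure lebesgue (L k) \<le> (\<Sum>n. emeasure lebesgue (C (k - int n)))"
      unfolding L_def using C by (intro emeasure_subadditive_countably) auto
    also have "\<dots> = (\<Sum>n. ennreal (\<omega> * ?b k ^ DIM('a) * x ^ n))"
    proof -
      have "emeasure lebesgue (C (k - int n)) = ennreal (\<omega> * ?b k ^ DIM('a) * x ^ n)" for n
        unfolding C(3) ball pw by (simp only: mult.assoc)
      then show ?thesis by simp
    qed
    also have "\<dots> = ennreal (\<omega> * ?b k ^ DIM('a) / (1 - x))"
    proof (intro suminf_ennreal_eq)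
      show "(\<lambda>n. \<omega> * ?b k ^ DIM('a) * x ^ n) sums (\<omega> * ?b k ^ DIM('a) / (1 - x))"
        using sums_mult[OF geometric_sums[of x], of "\<omega> * ?b k ^ DIM('a)"] x by simp
    qed (use x \<omega> q in auto)
    finally show ?thesis .
  qed
  obtain K where "admissible_kernel s K" 
    "\<And>k. {y. ennreal ((q powr of_int k) powr (- real DIM('a) - s)) < K y} \<subseteq> L k"
  proof (rule admissible_kernel_of_nested_sets[OF s, of L ?b])
    show "emeasure lebesgue (L k) \<noteq> \<infinity>" for k
      using L_bound[of k] by (auto simp: top_unique)
    show "\<exists>k. emeasure lebesgue (L k) < e" if e: "0 < e" for e
    proof -
      have "(\<lambda>n. \<omega> / (1 - x) * x ^ n) \<longlonglongrightarrow> \<omega> / (1 - x) * 0"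
        using x by (intro tendsto_intros LIMSEQ_power_zero) auto
      then have "(\<lambda>n. ennreal (\<omega> / (1 - x) * x ^ n)) \<longlonglongrightarrow> ennreal (\<omega> / (1 - x) * 0)"
        by (rule tendsto_ennrealI)
      then have "(\<lambda>n. ennreal (\<omega> / (1 - x) * x ^ n)) \<longlonglongrightarrow> 0" by simp
      from order_tendstoD(2)[OF this e] obtain n where n: "ennreal (\<omega> / (1 - x) * x ^ n) < e"
        by (auto simp: eventually_sequentially)
      have "emeasure lebesgue (L (0 - int n)) \<le> ennreal (\<omega> * ?b (0 - int n) ^ DIM('a) / (1 - x))"
        by (rule L_bound)
      also have "\<dots> < e" using n q unfolding pw by simp
      finally show ?thesis ..
    qed
    show "\<exists>k. r \<le> ?b k" for r
    proof -
      obtain n where "r < q ^ n" using real_arch_pow[OF q] by blast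
      then show ?thesis using q by (intro exI[of _ "int n"]) (simp add: powr_realpow)
    qed
    show "emeasure lebesgue (ball (0::'a) (?b k)) \<le> emeasure lebesgue (L k)" for k
      unfolding C(3)[symmetric] by (rule emeasure_mono[OF CL]) simp
  qed (use \<open>mono L\<close> q in auto)
  then show ?thesis using that LA by blast
qed

section \<open>Shells indexed by the integers\<close>

lemma nn_integral_int_geometric_finite:
  fixes x :: real
  assumes "0 < x" "x < 1"
  shows "(\<integral>\<^sup>+ k. ennreal (x ^ nat \<bar>k\<bar>) \<partial>count_space (UNIV :: int set)) < \<infinity>"
proof -
  let ?f = "\<lambda>k::int. ennreal (x ^ nat \<bar>k\<bar>)"
  have geo: "(\<integral>\<^sup>+ k. ?f k * indicator (range g) k \<partial>count_space UNIV) = ennreal (1 / (1 - x))"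
    if g: "inj g" "\<And>n. nat \<bar>g n\<bar> = n" for g :: "nat \<Rightarrow> int"
  proof -
    have "(\<integral>\<^sup>+ k. ?f k * indicator (range g) k \<partial>count_space UNIV) = (\<integral>\<^sup>+ k. ?f k \<partial>count_space (range g))"
      by (simp add: nn_integral_count_space_indicator)
    also have "\<dots> = (\<integral>\<^sup>+ n. ?f (g n) \<partial>count_space UNIV)"
      by (rule nn_integral_bij_count_space[symmetric]) (rule inj_on_imp_bij_betw[OF g(1)])
    also have "\<dots> = (\<Sum>n. ennreal (x ^ n))"
      by (simp add: nn_integral_count_space_nat g(2))
    also have "\<dots> = ennreal (1 / (1 - x))"
      using assms by (intro suminf_ennreal_eq geometric_sums) auto
    finally show ?thesis .
  qed
  have cover: "k \<in> range int \<union> range (\<lambda>n. - int n)" for k :: int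
    by (cases k rule: int_cases2) auto
  \<comment> \<open>The index \<open>0\<close> lies in both ranges and is counted twice, hence only
    an inequality.\<close>
  have "(\<integral>\<^sup>+ k. ?f k \<partial>count_space UNIV) \<le>
      (\<integral>\<^sup>+ k. ?f k * indicator (range int) k + ?f k * indicator (range (\<lambda>n. - int n)) k \<partial>count_space UNIV)"
    using cover by (intro nn_integral_mono) (auto split: split_indicator)
  also have "\<dots> = (\<integral>\<^sup>+ k. ?f k * indicator (range int) k \<partial>count_space UNIV) + (\<integral>\<^sup>+ k. ?f k * indicator (range (\<lambda>n. - int n)) k \<partial>count_space UNIV)"
    by (rule nn_integral_add) auto
  also have "\<dots> = ennreal (1 / (1 - x)) + ennreal (1 / (1 - x))"
    using geo[of int] geo[of "\<lambda>n. - int n"] by (simp add: inj_def)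
  also have "\<dots> < \<infinity>" by simp
  finally show ?thesis .
qed

text \<open>This is countable additivity of the measure with density \<open>f\<close>. Sums over the
  integers are written as integrals over \<open>count_space\<close>.\<close>

lemma nn_integral_disjoint_UN:
  fixes P :: "'i::countable \<Rightarrow> 'b set"
  assumes f [measurable]: "f \<in> borel_measurable M" and P [measurable]: "\<And>k. P k \<in> sets M"
    and disj: "disjoint_family P"
  shows "(\<integral>\<^sup>+ y. f y * indicator (\<Union>k. P k) y \<partial>M) = (\<integral>\<^sup>+ k. (\<integral>\<^sup>+ y. f y * indicator (P k) y \<partial>M) \<partial>count_space UNIV)"
proof -
  have "(\<integral>\<^sup>+ y. f y * indicator (\<Union>k. P k) y \<partial>M) = emeasure (density M f) (\<Union>k. P k)"
    by (simp add: emeasure_density)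
  also have "\<dots> = (\<integral>\<^sup>+ k. emeasure (density M f) (P k) \<partial>count_space UNIV)"
    using disj by (intro emeasure_UN_countable) auto
  finally show ?thesis by (simp add: emeasure_density)
qed

text \<open>The set where \<open>K\<close> is infinite lies in every superlevel set, so its measure
  is at most that of arbitrarily small balls.\<close>

lemma admissible_kernel_AE_finite:
  fixes K :: "'a::euclidean_space \<Rightarrow> ennreal"
  assumes "admissible_kernel s K"
  shows "AE y in lebesgue. K y < \<infinity>"
proof -
  have [measurable]: "K \<in> borel_measurable lebesgue" using assms unfolding admissible_kernel_def by blast
  define N where "N = {y \<in> space lebesgue. K y = \<infinity>}"
  have N [measurable]: "N \<in> sets lebesgue" unfolding N_def by measurable
  have "emeasure lebesgue N \<le> ennreal (unit_ball_vol DIM('a) * r ^ DIM('a))" if "0 < r" for r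
  proof -
    have meas: "{y \<in> space lebesgue. ennreal (r powr (- real DIM('a) - s)) < K y} \<in> sets lebesgue"
      by measurable
    have "N \<subseteq> {y \<in> space lebesgue. ennreal (r powr (- real DIM('a) - s)) < K y}"
      unfolding N_def by (auto simp: less_top)
    from emeasure_mono[OF this meas]
    have "emeasure lebesgue N \<le> emeasure lebesgue {y \<in> space lebesgue. ennreal (r powr (- real DIM('a) - s)) < K y}"
      .
    also have "{y \<in> space lebesgue. ennreal (r powr (- real DIM('a) - s)) < K y} = {y. ennreal (r powr (- real DIM('a) - s)) < K y}"
      by simp
    also have "emeasure lebesgue \<dots> = emeasure lebesgue (ball (0::'a) r)"
      using assms that unfolding admissible_kernel_def by blast
    also have "\<dots> = ennreal (unit_ball_vol DIM('a) * r ^ DIM('a))" using that by (simp add: emeasure_ball)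
    finally show ?thesis .
  qed
  then have le: "emeasure lebesgue N \<le> ennreal (unit_ball_vol DIM('a) * inverse (real (Suc n)) ^ DIM('a))" for n
    by simp
  have "(\<lambda>n. unit_ball_vol DIM('a) * inverse (real (Suc n)) ^ DIM('a)) \<longlonglongrightarrow> unit_ball_vol DIM('a) * 0 ^ DIM('a)"
    by (intro tendsto_intros LIMSEQ_inverse_real_of_nat)
  from tendsto_ennrealI[OF this]
  have lim: "(\<lambda>n. ennreal (unit_ball_vol DIM('a) * inverse (real (Suc n)) ^ DIM('a))) \<longlonglongrightarrow> ennreal (unit_ball_vol DIM('a) * 0 ^ DIM('a))" .
  have "emeasure lebesgue N \<le> ennreal (unit_ball_vol DIM('a) * 0 ^ DIM('a))"
    by (rule LIMSEQ_le_const[OF lim]) (use le in blast)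
  then have "emeasure lebesgue N = 0" by (simp add: zero_power)
  then have "N \<in> null_sets lebesgue" using N by auto
  then show ?thesis by (rule AE_I') (auto simp: N_def less_top[symmetric])
qed

section \<open>Upper bound: an almost optimal kernel\<close>

text \<open>On the shell \<open>P k\<close>, of volume \<open>V k\<close>, one has
  \<open>K \<le> a k\<close> and \<open>w \<le> l k\<close>. On the annulus between the radii
  \<open>b (k + 1)\<close> and \<open>b (k + 2)\<close>, of volume \<open>V (k + 1)\<close>, one has
  \<open>v \<ge> \<nu> (k + 1)\<close> and a radial kernel of at least \<open>a (k + 2)\<close>. The
  part \<open>\<nu> (k + 1)\<close> of \<open>l k\<close> yields the main term, and the excess sums
  to at most \<open>\<eta>\<close>.\<close>

lemma admissible_kernel_nn_integral_le:
  fixes w v :: "'a::euclidean_space \<Rightarrow> real"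
  assumes s: "0 < s" and q: "1 < q" and \<eta>: "0 < \<eta>" and rr: "radial_rearrangement w v"
    and w: "w \<in> borel_measurable lebesgue"
  obtains K where "admissible_kernel s K"
    "(\<integral>\<^sup>+ y. ennreal (w y) * K y \<partial>lebesgue) \<le> ennreal (q powr (real DIM('a) + 2 * s)) *
       (\<integral>\<^sup>+ y. ennreal (v y) * ennreal (norm y powr (- real DIM('a) - s)) \<partial>lebesgue) + ennreal \<eta>"
proof -
  define D where "D = real DIM('a)"
  have D: "0 < D" by (simp add: D_def)
  define b where "b k = q powr of_int k" for k :: int
  define a where "a k = b k powr (- D - s)" for k
  define \<omega> where "\<omega> = unit_ball_vol D"
  define V where "V k = \<omega> * (b (k + 1) ^ DIM('a) - b k ^ DIM('a))" for k
  define \<Omega> where "\<Omega> = \<omega> * (q powr D - 1)"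
  have \<omega>: "0 < \<omega>" using D by (simp add: \<omega>_def)
  have b_pos: "0 < b k" for k using q by (simp add: b_def)
  have b_mono: "b j \<le> b k" if "j \<le> k" for j k using that q by (simp add: b_def)
  have b_pow: "b k ^ DIM('a) = q powr (D * of_int k)" for k
    using q by (simp add: b_def D_def powr_powr mult.commute flip: powr_realpow)
  have a_q: "a k = q powr (of_int k * (- D - s))" for k
    by (simp add: a_def b_def powr_powr)
  have a_pos: "0 < a k" for k using b_pos[of k] by (simp add: a_def)
  have a_less: "a k < a j" if "j < k" for j k
    unfolding a_q using that q D s by (simp add: mult_less_cancel_right)
  have "1 < q powr D" using q D by (simp add: gr_one_powr)
  then have \<Omega>: "0 < \<Omega>" using \<omega> by (simp add: \<Omega>_def)
  have V_q: "V k = \<Omega> * q powr (D * of_int k)" for k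
  proof -
    have "q powr (D * of_int (k + 1)) = q powr D * q powr (D * of_int k)"
      by (simp add: distrib_left powr_add)
    then show ?thesis unfolding V_def b_pow \<Omega>_def by (simp add: algebra_simps)
  qed
  have V_nonneg: "0 \<le> V k" for k unfolding V_q using \<Omega> by simp
  have aV: "a k * V k = \<Omega> * q powr (- s * of_int k)" for k
    unfolding a_q V_q by (simp add: algebra_simps flip: powr_add)
  \<comment> \<open>Two steps in the kernel cost \<open>2 * (D + s)\<close> in the exponent, and one
    step in the volume regains \<open>D\<close>.\<close>
  have aV_shift: "a k * V k = q powr (D + 2 * s) * (a (k + 2) * V (k + 1))" for k
  proof -
    have "q powr (D + 2 * s) * (a (k + 2) * V (k + 1)) =
        \<Omega> * (q powr (D + 2 * s) * (q powr (of_int (k + 2) * (- D - s)) * q powr (D * of_int (k + 1))))"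
      unfolding a_q V_q by (simp only: mult_ac)
    also have "\<dots> = \<Omega> * q powr (- s * of_int k)"
      by (simp only: powr_add[symmetric]) (simp add: algebra_simps)
    finally show ?thesis by (simp add: aV)
  qed
  have ball: "emeasure lebesgue (ball (0::'a) (b k)) = ennreal (\<omega> * b k ^ DIM('a))" for k
    using b_pos[of k] by (simp add: emeasure_ball \<omega>_def D_def)
  have ballD: "ennreal (\<omega> * b (k + 1) ^ DIM('a)) - ennreal (\<omega> * b k ^ DIM('a)) = ennreal (V k)" for k
    using \<omega> b_pos[of k] by (subst ennreal_minus) (simp_all add: V_def algebra_simps)

  \<comment> \<open>Increasing in \<open>k\<close>, yet small enough at \<open>- \<infinity>\<close> to be summable against the masses \<open>a k * V k\<close>.\<close>
  define \<mu> where "\<mu> k = min 1 (b k powr (2 * s))" for k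
  have \<mu>_pos: "0 < \<mu> k" for k using b_pos[of k] by (simp add: \<mu>_def)
  have \<mu>_mono: "\<mu> j \<le> \<mu> k" if "j \<le> k" for j k
  proof -
    have "b j powr (2 * s) \<le> b k powr (2 * s)"
      using b_mono[OF that] b_pos[of j] s by (intro powr_mono2) auto
    then show ?thesis by (auto simp: \<mu>_def)
  qed
  define c where "c = (\<integral>\<^sup>+ k. ennreal (\<mu> k * (a k * V k)) \<partial>count_space UNIV)"
  have c: "c < \<infinity>"
  proof -
    define x where "x = q powr - s"
    have x: "0 < x" "x < 1" using q s by (auto simp: x_def powr_less_one)
    have "\<mu> k * (a k * V k) \<le> \<Omega> * x ^ nat \<bar>k\<bar>" for k
    proof -
      \<comment> \<open>For \<open>k \<ge> 0\<close> the power decays by itself. For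
        \<open>k < 0\<close> it grows, and the factor \<open>b k powr (2 * s)\<close> reverses the
        sign of the exponent.\<close>
      have "\<mu> k * q powr (- s * of_int k) \<le> q powr (- s * of_int \<bar>k\<bar>)"
      proof (cases "0 \<le> k")
        case True
        then show ?thesis by (simp add: \<mu>_def mult_left_le_one_le b_pos)
      next
        case False
        have "\<mu> k * q powr (- s * of_int k) \<le> b k powr (2 * s) * q powr (- s * of_int k)"
          by (intro mult_right_mono) (auto simp: \<mu>_def)
        also have "\<dots> = q powr (2 * s * of_int k + (- s * of_int k))"
          by (simp only: b_def powr_powr powr_add) (simp add: mult_ac)
        also have "\<dots> = q powr (- s * of_int \<bar>k\<bar>)" using False by (simp add: algebra_simps)
        finally show ?thesis .
      qed
      also have "\<dots> = x ^ nat \<bar>k\<bar>"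
        using x by (simp add: x_def powr_powr flip: powr_realpow)
      finally show ?thesis using \<Omega> by (simp add: aV mult.left_commute)
    qed
    then have "c \<le> (\<integral>\<^sup>+ k. ennreal \<Omega> * ennreal (x ^ nat \<bar>k\<bar>) \<partial>count_space UNIV)"
      unfolding c_def using \<Omega> x by (intro nn_integral_mono) (simp add: ennreal_mult[symmetric] ennreal_leI)
    also have "\<dots> = ennreal \<Omega> * (\<integral>\<^sup>+ k. ennreal (x ^ nat \<bar>k\<bar>) \<partial>count_space UNIV)"
      by (rule nn_integral_cmult) simp
    also have "\<dots> < \<infinity>"
      using nn_integral_int_geometric_finite[OF x] by (simp add: ennreal_mult_less_top)
    finally show ?thesis .
  qed
  \<comment> \<open>Chosen so that the total excess \<open>h * c\<close> is at most
    \<open>\<eta>\<close>; the summand \<open>1\<close> avoids division by zero.\<close>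
  define h where "h = \<eta> / (1 + enn2real c)"
  have h: "0 < h" using \<eta> by (simp add: h_def add_pos_nonneg)
  have hc: "ennreal h * c \<le> ennreal \<eta>"
  proof -
    have "c = ennreal (enn2real c)" using c by simp
    moreover have "h * enn2real c \<le> \<eta>"
      using \<eta> by (simp add: h_def divide_le_eq add_pos_nonneg mult_left_mono)
    ultimately show ?thesis
      using h by (metis enn2real_nonneg ennreal_leI ennreal_mult less_imp_le)
  qed

  obtain e :: 'a where e: "norm e = 1" using vector_choose_size zero_le_one by blast
  define \<nu> where "\<nu> k = v (b k *\<^sub>R e)" for k
  have norm_be: "norm (b k *\<^sub>R e) = b k" for k using e b_pos[of k] by simp
  have \<nu>_nonneg: "0 \<le> \<nu> k" for k using rr unfolding radial_rearrangement_def \<nu>_def by blast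
  have \<nu>_mono: "\<nu> j \<le> \<nu> k" if "j \<le> k" for j k
    unfolding \<nu>_def by (rule radial_rearrangement_mono[OF rr]) (simp only: norm_be b_mono[OF that])
  \<comment> \<open>The strict excess makes \<open>{v < l k}\<close> contain the ball of radius
    \<open>b (k + 1)\<close>, and keeps \<open>l k\<close> positive as the rearrangement identity
    requires.\<close>
  define l where "l k = \<nu> (k + 1) + h * \<mu> k" for k
  have l_nu: "\<nu> (k + 1) < l k" for k using h \<mu>_pos[of k] by (simp add: l_def)
  have l_pos: "0 < l k" for k using l_nu[of k] \<nu>_nonneg[of "k + 1"] by simp
  have l_mono: "l j \<le> l k" if "j \<le> k" for j k
    unfolding l_def using that h by (intro add_mono \<nu>_mono mult_left_mono \<mu>_mono) auto
  \<comment> \<open>The shift pairs radius \<open>b k\<close> with a level just above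
    \<open>\<nu> k\<close>; the shell \<open>P k\<close>, contained in \<open>E (k + 1)\<close>,
    then sees the level \<open>l k\<close>.\<close>
  define A where "A k = {y. w y < l (k - 1)}" for k
  have "{y \<in> space lebesgue. w y < l (k - 1)} \<in> sets lebesgue" for k using w by measurable
  then have A: "A k \<in> sets lebesgue" for k by (simp add: A_def)
  have A_mono: "mono A"
  proof (rule monoI)
    fix j k :: int assume "j \<le> k"
    then show "A j \<subseteq> A k" using l_mono[of "j - 1" "k - 1"] by (auto simp: A_def)
  qed
  have vm: "v \<in> borel_measurable lebesgue"
    using radial_rearrangement_measurable[OF rr] by (simp add: measurable_completion)
  have A_big: "emeasure lebesgue (ball (0::'a) (b k)) \<le> emeasure lebesgue (A k)" for k
  proof -
    have "{y \<in> space lebesgue. v y < l (k - 1)} \<in> sets lebesgue" using vm by measurable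
    then have m: "{y. v y < l (k - 1)} \<in> sets lebesgue" by simp
    have "ball 0 (b k) \<subseteq> {y. v y < l (k - 1)}"
    proof
      fix y :: 'a assume "y \<in> ball 0 (b k)"
      then have "norm y \<le> norm (b k *\<^sub>R e)" by (simp only: norm_be) simp
      then have "v y \<le> \<nu> k" unfolding \<nu>_def by (rule radial_rearrangement_mono[OF rr])
      also have "\<dots> < l (k - 1)" using l_nu[of "k - 1"] by simp
      finally show "y \<in> {y. v y < l (k - 1)}" by simp
    qed
    from emeasure_mono[OF this m]
    have "emeasure lebesgue (ball (0::'a) (b k)) \<le> emeasure lebesgue {y. v y < l (k - 1)}" .
    also have "\<dots> = emeasure lebesgue (A k)"
      using rr l_pos[of "k - 1"] unfolding radial_rearrangement_def A_def by metis
    finally show ?thesis .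
  qed
  obtain K where K: "admissible_kernel s K" and K_sub: "\<And>k. {y. ennreal (a k) < K y} \<subseteq> A k"
    by (rule admissible_kernel_superlevels_subset[OF s q A A_mono A_big[unfolded b_def]])
      (simp add: a_def b_def D_def)
  have Km [measurable]: "K \<in> borel_measurable lebesgue" using K unfolding admissible_kernel_def by blast
  have wm [measurable]: "w \<in> borel_measurable lebesgue" by (rule w)
  define E where "E k = {y. ennreal (a k) < K y}" for k
  have "{y \<in> space lebesgue. ennreal (a k) < K y} \<in> sets lebesgue" for k by measurable
  then have Em: "E k \<in> sets lebesgue" for k by (simp add: E_def)
  have E_meas: "emeasure lebesgue (E k) = ennreal (\<omega> * b k ^ DIM('a))" for k
    using K b_pos[of k] unfolding admissible_kernel_def E_def a_def D_def ball[symmetric] by blast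
  have E_mono: "E j \<subseteq> E k" if "j \<le> k" for j k
  proof -
    have "a k \<le> a j" using a_less[of j k] that by (cases "j = k") auto
    then show ?thesis unfolding E_def using ennreal_leI by (auto intro: le_less_trans)
  qed
  define P where "P k = E (k + 1) - E k" for k
  have Pm: "P k \<in> sets lebesgue" for k unfolding P_def using Em by (intro sets.Diff)
  have P_meas: "emeasure lebesgue (P k) = ennreal (V k)" for k
    unfolding P_def using E_mono[of k "k + 1"] Em by (subst emeasure_Diff) (simp_all add: E_meas ballD)
  have disj: "disjoint_family P"
  proof -
    have "P j \<inter> P k = {}" if "j < k" for j k
      using E_mono[of "j + 1" k] that unfolding P_def by auto
    then show ?thesis unfolding disjoint_family_on_def by (metis Int_commute linorder_neqE)
  qed
  \<comment> \<open>The levels \<open>a k\<close> tend to \<open>0\<close> upwards in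
    \<open>k\<close> and to infinity downwards, so every finite positive value is caught between two
    consecutive ones.\<close>
  have in_P: "y \<in> (\<Union>k. P k)" if y: "K y < \<infinity>" "K y \<noteq> 0" for y
  proof -
    obtain r where r: "K y = ennreal r" "0 < r"
      using y by (cases "K y") (auto simp: less_le)
    have "((\<lambda>n. inverse (q powr (D + s)) ^ n) \<longlonglongrightarrow> 0)"
      using q D s by (intro LIMSEQ_power_zero) (simp add: inverse_less_1_iff gr_one_powr)
    from order_tendstoD(2)[OF this r(2)] obtain n where n: "inverse (q powr (D + s)) ^ n < r"
      by (auto simp: eventually_sequentially)
    have "a (int n) = inverse (q powr (D + s)) ^ n"
    proof -
      have "a (int n) = q powr (- (D + s) * real n)" by (simp add: a_q algebra_simps)
      also have "\<dots> = (q powr - (D + s)) powr real n" by (simp add: powr_powr)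
      also have "\<dots> = (q powr - (D + s)) ^ n" using q by (simp add: powr_realpow)
      finally show ?thesis by (simp only: powr_minus)
    qed
    with n r have "y \<in> E (int n)" using a_pos[of "int n"] by (simp add: E_def ennreal_less_iff)
    moreover obtain m where "r < (q powr (D + s)) ^ m"
      using real_arch_pow[of "q powr (D + s)" r] q D s by (auto simp: gr_one_powr)
    moreover have "a (- int m) = (q powr (D + s)) ^ m"
    proof -
      have "a (- int m) = q powr ((D + s) * real m)" by (simp add: a_q algebra_simps)
      also have "\<dots> = (q powr (D + s)) powr real m" by (simp add: powr_powr)
      finally show ?thesis using q by (simp add: powr_realpow)
    qed
    ultimately have "y \<in> E (int n)" "y \<notin> E (- int m)"
      using r by (simp_all add: E_def ennreal_less_iff)
    moreover have "mono (\<lambda>k. y \<in> E k)" using E_mono by (auto simp: mono_def)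
    ultimately show ?thesis using int_threshold[of "\<lambda>k. y \<in> E k"] by (auto simp: P_def)
  qed
  have shell_le: "(\<integral>\<^sup>+ y. ennreal (w y) * K y * indicator (P k) y \<partial>lebesgue) \<le> ennreal (l k * (a k * V k))" for k
  proof -
    have "(\<integral>\<^sup>+ y. ennreal (w y) * K y * indicator (P k) y \<partial>lebesgue) \<le>
        (\<integral>\<^sup>+ y. ennreal (l k * a k) * indicator (P k) y \<partial>lebesgue)"
    proof (intro nn_integral_mono)
      fix y
      show "ennreal (w y) * K y * indicator (P k) y \<le> ennreal (l k * a k) * indicator (P k) y"
      proof (cases "y \<in> P k")
        case True
        then have "y \<in> A (k + 1)" "K y \<le> ennreal (a k)" using K_sub[of "k + 1"] by (auto simp: P_def E_def)
        then have "w y \<le> l k" "K y \<le> ennreal (a k)" by (auto simp: A_def)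
        then have "ennreal (w y) * K y \<le> ennreal (l k) * ennreal (a k)"
          by (intro mult_mono ennreal_leI) auto
        then show ?thesis using True l_pos[of k] a_pos[of k] by (simp add: ennreal_mult less_imp_le)
      qed simp
    qed
    also have "\<dots> = ennreal (l k * a k) * ennreal (V k)"
      using Pm P_meas by (simp add: nn_integral_cmult_indicator)
    also have "\<dots> = ennreal (l k * (a k * V k))"
      using l_pos[of k] a_pos[of k] V_nonneg[of k] by (simp add: ennreal_mult[symmetric] mult.assoc)
    finally show ?thesis .
  qed
  define I where "I = (\<integral>\<^sup>+ y. ennreal (v y) * ennreal (norm y powr (- D - s)) \<partial>(lebesgue :: 'a measure))"
  \<comment> \<open>A lower sum for \<open>I\<close> over disjoint annuli: \<open>v\<close> is taken
    at the inner radius and the radial kernel at the outer one.\<close>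
  have I_ge: "(\<integral>\<^sup>+ k. ennreal (\<nu> (k + 1) * (a (k + 2) * V (k + 1))) \<partial>count_space UNIV) \<le> I"
  proof -
    define R where "R k = ball (0::'a) (b (k + 2)) - ball 0 (b (k + 1))" for k
    define f where "f y = ennreal (v y) * ennreal (norm (y::'a) powr (- D - s))" for y
    have "(\<lambda>y::'a. ennreal (norm y powr (- D - s))) \<in> borel_measurable lebesgue"
      by (intro measurable_completion) simp
    then have fm: "f \<in> borel_measurable lebesgue" using vm unfolding f_def by measurable
    have Rm: "R k \<in> sets lebesgue" for k unfolding R_def by (intro sets.Diff) auto
    have R_meas: "emeasure lebesgue (R k) = ennreal (V (k + 1))" for k
    proof -
      have "ball 0 (b (k + 1)) \<subseteq> ball (0::'a) (b (k + 2))" using b_mono[of "k + 1" "k + 2"] by auto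
      then have "emeasure lebesgue (R k) = emeasure lebesgue (ball (0::'a) (b (k + 2))) - emeasure lebesgue (ball (0::'a) (b (k + 1)))"
        unfolding R_def by (intro emeasure_Diff) (auto simp: ball[unfolded emeasure_completion])
      also have "\<dots> = ennreal (V (k + 1))" unfolding ball using ballD[of "k + 1"] by (simp add: add.assoc)
      finally show ?thesis .
    qed
    have R_disj: "disjoint_family R"
    proof -
      have "R j \<inter> R k = {}" if "j < k" for j k
        using b_mono[of "j + 2" "k + 1"] that unfolding R_def by auto
      then show ?thesis unfolding disjoint_family_on_def by (metis Int_commute linorder_neqE)
    qed
    have "ennreal (\<nu> (k + 1) * (a (k + 2) * V (k + 1))) \<le> (\<integral>\<^sup>+ y. f y * indicator (R k) y \<partial>lebesgue)" for k
    proof -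
      have "ennreal (\<nu> (k + 1) * (a (k + 2) * V (k + 1))) = ennreal (\<nu> (k + 1) * a (k + 2)) * ennreal (V (k + 1))"
        using \<nu>_nonneg[of "k + 1"] a_pos[of "k + 2"] V_nonneg[of "k + 1"]
        by (simp add: ennreal_mult[symmetric] mult.assoc)
      also have "\<dots> = (\<integral>\<^sup>+ y. ennreal (\<nu> (k + 1) * a (k + 2)) * indicator (R k) y \<partial>lebesgue)"
        using Rm R_meas by (simp add: nn_integral_cmult_indicator)
      also have "\<dots> \<le> (\<integral>\<^sup>+ y. f y * indicator (R k) y \<partial>lebesgue)"
      proof (intro nn_integral_mono)
        fix y
        show "ennreal (\<nu> (k + 1) * a (k + 2)) * indicator (R k) y \<le> f y * indicator (R k) y"
        proof (cases "y \<in> R k")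
          case True
          then have y: "b (k + 1) \<le> norm y" "norm y < b (k + 2)" by (auto simp: R_def)
          then have "norm (b (k + 1) *\<^sub>R e) \<le> norm y" by (simp only: norm_be)
          then have "\<nu> (k + 1) \<le> v y" unfolding \<nu>_def by (rule radial_rearrangement_mono[OF rr])
          moreover have "a (k + 2) \<le> norm y powr (- D - s)"
            unfolding a_def using y b_pos[of "k + 1"] D s by (intro powr_mono2') auto
          ultimately have "ennreal (\<nu> (k + 1)) * ennreal (a (k + 2)) \<le> f y"
            unfolding f_def by (intro mult_mono ennreal_leI) auto
          then show ?thesis
            using True \<nu>_nonneg[of "k + 1"] a_pos[of "k + 2"] by (simp add: ennreal_mult less_imp_le)
        qed simp
      qed
      finally show ?thesis .
    qed
    then have "(\<integral>\<^sup>+ k. ennreal (\<nu> (k + 1) * (a (k + 2) * V (k + 1))) \<partial>count_space UNIV) \<le>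
        (\<integral>\<^sup>+ k. (\<integral>\<^sup>+ y. f y * indicator (R k) y \<partial>lebesgue) \<partial>count_space UNIV)"
      by (intro nn_integral_mono)
    also have "\<dots> = (\<integral>\<^sup>+ y. f y * indicator (\<Union>k. R k) y \<partial>lebesgue)"
      by (rule nn_integral_disjoint_UN[symmetric, OF fm Rm R_disj])
    also have "\<dots> \<le> I"
      unfolding I_def f_def by (intro nn_integral_mono) (simp add: indicator_def)
    finally show ?thesis .
  qed
  have "(\<integral>\<^sup>+ y. ennreal (w y) * K y \<partial>lebesgue) = (\<integral>\<^sup>+ y. ennreal (w y) * K y * indicator (\<Union>k. P k) y \<partial>lebesgue)"
  proof (rule nn_integral_cong_AE)
    \<comment> \<open>Off the shells \<open>K\<close> is zero or infinite, and the latter happens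
      only on a null set.\<close>
    show "AE y in lebesgue. ennreal (w y) * K y = ennreal (w y) * K y * indicator (\<Union>k. P k) y"
      using admissible_kernel_AE_finite[OF K]
    proof eventually_elim
      case (elim y)
      then show ?case using in_P[of y] by (cases "K y = 0") auto
    qed
  qed
  also have "\<dots> = (\<integral>\<^sup>+ k. (\<integral>\<^sup>+ y. ennreal (w y) * K y * indicator (P k) y \<partial>lebesgue) \<partial>count_space UNIV)"
    by (rule nn_integral_disjoint_UN[OF _ Pm disj]) measurable
  also have "\<dots> \<le> (\<integral>\<^sup>+ k. ennreal (l k * (a k * V k)) \<partial>count_space UNIV)"
    by (intro nn_integral_mono shell_le)
  also have "\<dots> = (\<integral>\<^sup>+ k. ennreal (q powr (D + 2 * s)) * ennreal (\<nu> (k + 1) * (a (k + 2) * V (k + 1))) +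
      ennreal h * ennreal (\<mu> k * (a k * V k)) \<partial>count_space UNIV)"
  proof (intro nn_integral_cong)
    fix k :: int
    have pos: "0 \<le> \<nu> (k + 1) * (a (k + 2) * V (k + 1))" "0 \<le> \<mu> k * (a k * V k)"
      using \<nu>_nonneg a_pos V_nonneg \<mu>_pos by (auto intro!: mult_nonneg_nonneg simp: less_imp_le)
    have "l k * (a k * V k) = \<nu> (k + 1) * (a k * V k) + h * (\<mu> k * (a k * V k))"
      by (simp add: l_def algebra_simps)
    also have "\<nu> (k + 1) * (a k * V k) = q powr (D + 2 * s) * (\<nu> (k + 1) * (a (k + 2) * V (k + 1)))"
      by (subst aV_shift) (simp only: mult.left_commute)
    finally show "ennreal (l k * (a k * V k)) = ennreal (q powr (D + 2 * s)) * ennreal (\<nu> (k + 1) * (a (k + 2) * V (k + 1))) +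
      ennreal h * ennreal (\<mu> k * (a k * V k))"
      using pos h by (simp only: ennreal_plus ennreal_mult mult_nonneg_nonneg less_imp_le powr_ge_zero)
  qed
  also have "\<dots> = (\<integral>\<^sup>+ k. ennreal (q powr (D + 2 * s)) * ennreal (\<nu> (k + 1) * (a (k + 2) * V (k + 1))) \<partial>count_space UNIV) +
      (\<integral>\<^sup>+ k. ennreal h * ennreal (\<mu> k * (a k * V k)) \<partial>count_space UNIV)"
    by (rule nn_integral_add) simp_all
  also have "\<dots> = ennreal (q powr (D + 2 * s)) * (\<integral>\<^sup>+ k. ennreal (\<nu> (k + 1) * (a (k + 2) * V (k + 1))) \<partial>count_space UNIV) + ennreal h * c"
    unfolding c_def by (simp only: nn_integral_cmult borel_measurable_count_space)
  also have "\<dots> \<le> ennreal (q powr (D + 2 * s)) * I + ennreal \<eta>"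
    by (intro add_mono mult_left_mono I_ge hc) simp
  finally show ?thesis using that[OF K] by (simp add: I_def D_def)
qed

section \<open>Equality of the infimum with the radial integral, and passage to the supremum\<close>

lemma INF_admissible_kernel_eq:
  fixes w v :: "'a::euclidean_space \<Rightarrow> real"
  assumes s: "0 < s" and rr: "radial_rearrangement w v" and w: "w \<in> borel_measurable lebesgue"
  shows "(INF K \<in> {K. admissible_kernel s K}. \<integral>\<^sup>+ y. ennreal (w y) * K y \<partial>lebesgue) =
    (\<integral>\<^sup>+ y. ennreal (v y) * ennreal (norm y powr (- real DIM('a) - s)) \<partial>lebesgue)"
    (is "?inf = ?I")
proof (rule antisym)
  show "?I \<le> ?inf"
    by (rule INF_greatest) (use nn_integral_admissible_kernel_ge[OF s _ rr w] in blast)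
  show "?inf \<le> ?I"
  \<comment> \<open>Finiteness of the radial integral is what lets its product with a factor tending
    to \<open>1\<close> converge back to it.\<close>
  proof (cases "?I = \<infinity>")
    case False
    then obtain r where r: "?I = ennreal r" "0 \<le> r" by (cases ?I) auto
    \<comment> \<open>One parameter drives both errors: \<open>q = 1 + d\<close> and
      \<open>\<eta> = d\<close>.\<close>
    have le: "?inf \<le> ennreal ((1 + d) powr (real DIM('a) + 2 * s) * r + d)" if d: "0 < d" for d
    proof -
      obtain K where K: "admissible_kernel s K"
        "(\<integral>\<^sup>+ y. ennreal (w y) * K y \<partial>lebesgue) \<le> ennreal ((1 + d) powr (real DIM('a) + 2 * s)) * ?I + ennreal d"
        by (rule admissible_kernel_nn_integral_le[OF s _ d rr w, of "1 + d"]) (use d in auto)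
      have "?inf \<le> (\<integral>\<^sup>+ y. ennreal (w y) * K y \<partial>lebesgue)"
        by (rule INF_lower) (use K in blast)
      also note K(2)
      also have "ennreal ((1 + d) powr (real DIM('a) + 2 * s)) * ?I + ennreal d =
          ennreal ((1 + d) powr (real DIM('a) + 2 * s) * r + d)"
        unfolding r(1) using r(2) d by (simp add: ennreal_mult)
      finally show ?thesis .
    qed
    have "((\<lambda>d. (1 + d) powr (real DIM('a) + 2 * s) * r + d) \<longlongrightarrow> (1 + 0) powr (real DIM('a) + 2 * s) * r + 0) (at_right 0)"
      by (intro tendsto_intros) auto
    from tendsto_ennrealI[OF this]
    have lim: "((\<lambda>d. ennreal ((1 + d) powr (real DIM('a) + 2 * s) * r + d)) \<longlongrightarrow> ennreal r) (at_right 0)" by simp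
    have "?inf \<le> ennreal r"
    proof (rule tendsto_lowerbound[OF lim])
      show "\<forall>\<^sub>F d in at_right 0. ?inf \<le> ennreal ((1 + d) powr (real DIM('a) + 2 * s) * r + d)"
        using eventually_at_right_less[of "0::real"] by eventually_elim (rule le)
    qed simp
    then show ?thesis by (simp only: r(1))
  qed simp
qed

theorem proposition3p6:
  fixes u :: "'a::euclidean_space \<Rightarrow> real" and x :: 'a and s :: real
    and v :: "'a \<Rightarrow> 'a \<Rightarrow> real"
  assumes "1 < s" and "s < 2"
    and "continuous_on UNIV u"
    and "\<And>p. p \<in> subdifferential u x \<Longrightarrow> radial_rearrangement (affine_remainder u x p) (v p)"
  shows "MA s u x = (SUP p \<in> subdifferential u x. scaled_neg_frac_laplacian s (v p) 0)"
proof -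
  have "enn2ereal (INF K \<in> {K. admissible_kernel s K}.
      \<integral>\<^sup>+ y. ennreal (affine_remainder u x p y) * K y \<partial>lebesgue) = scaled_neg_frac_laplacian s (v p) 0"
    if p: "p \<in> subdifferential u x" for p
  proof -
    let ?w = "affine_remainder u x p"
    note rr = assms(4)[OF p]
    have cont: "continuous_on UNIV ?w"
      unfolding affine_remainder_def
      by (intro continuous_intros continuous_on_compose2[OF assms(3)]) auto
    then have "?w \<in> borel_measurable lebesgue"
      by (intro measurable_completion) (simp add: borel_measurable_continuous_onI)
    moreover have "0 < s" using assms(1) by simp
    ultimately have inf: "(INF K \<in> {K. admissible_kernel s K}. \<integral>\<^sup>+ y. ennreal (?w y) * K y \<partial>lebesgue) =
        (\<integral>\<^sup>+ y. ennreal (v p y) * ennreal (norm y powr (- real DIM('a) - s)) \<partial>lebesgue)"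
      by (intro INF_admissible_kernel_eq[OF _ rr])
    have nonneg: "\<And>y. 0 \<le> v p y" and radial: "\<And>y z. norm y = norm z \<Longrightarrow> v p y = v p z"
      using rr unfolding radial_rearrangement_def by blast+
    have "v p 0 = 0"
      by (rule radial_rearrangement_zero[OF rr cont]) (simp add: affine_remainder_def)
    from scaled_neg_frac_laplacian_radial_0[of "v p", OF nonneg radial this] show ?thesis
      unfolding inf using nonneg by (simp add: ennreal_mult)
  qed
  \<comment> \<open>The suprema agree term by term; for an empty subdifferential both sides are
    \<open>bot\<close>, that is \<open>- \<infinity>\<close>.\<close>
  then show ?thesis
    by (simp add: MA_def bot_ereal_def cong: SUP_cong)
qed

end
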